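(* Let $d\ge 2$ be an integer and let $\omega$ be a $(1,d-1)$-weight vector. Let $\mathcal{M}$ be a connected analytic submanifold of $M_{1,d-1}\cong\mathbb{R}^{d-1}$. Assume that $\mathcal{M}$ is not contained in any proper affine hyperplane of $\mathbb{R}^{d-1}$. Then for Lebesgue almost every $x\in\mathcal{M}$, $\boldsymbol{L}^{\omega}(\Lambda_x,\cdot)$ is connected.
   Context: $M_{1,d-1}$ denotes the space of real $1\times(d-1)$ matrices. Lebesgue measure on an analytic submanifold means its natural volume measure. A vector $\omega=(\omega_1,\dots,\omega_d)\in\mathbb{R}^d$ is a $(1,d-1)$-weight vector if $\omega_1=1$, $\omega_2\ge\cdots\ge\omega_d>0$ and $\sum_{j=2}^d\omega_j=1$. For $t\in\mathbb{R}$ put $a^{\omega}_t=\mathrm{diag}(e^{\omega_1 t},e^{-\omega_2 t},\dots,e^{-\omega_d t})$. For $x\in M_{1,d-1}$ put $u(x)=\begin{pmatrix}1 & x\\ 0&\mathbb{I}_{d-1}\end{pmatrix}$ and $\Lambda_x=u(x)\mathbb{Z}^d$. A unimodular lattice is a lattice in $\mathbb{R}^d$ of covolume $1$. Let $\mathcal{C}$ be the closed unit cube of $\mathbb{R}^d$ centered at $0$ (its side length is immaterial below: rescaling $\mathcal{C}$ adds the same constant to all $L_i^\omega$). For a unimodular lattice $\Lambda$, $t\ge 0$ and $1\le i\le d$, $\lambda_i(a^{\omega}_t\Lambda)$ is the least $\lambda>0$ such that $\lambda\mathcal{C}$ contains $i$ linearly independent vectors of $a^{\omega}_t\Lambda$.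 Set $L^{\omega}_i(\Lambda,t)=\log\lambda_i(a^{\omega}_t\Lambda)$ and $\boldsymbol{L}^{\omega}(\Lambda,t)=(L^{\omega}_1(\Lambda,t),\dots,L^{\omega}_d(\Lambda,t))$. For $k\in\{1,\dots,d-1\}$, $\boldsymbol{L}^{\omega}(\Lambda,\cdot)$ is connected at $k$ if the set $\{t\ge 0: L^{\omega}_k(\Lambda,t)=L^{\omega}_{k+1}(\Lambda,t)\}$ is unbounded above; it is connected if it is connected at every $1\le k\le d-1$. *)

theory Defs
  imports "HOL-Analysis.Analysis"
begin

section \<open>Analytic submanifolds and their volume measure\<close>

text \<open>A multi-index is a function \<open>\<alpha> :: 'm \<Rightarrow> nat\<close>; unconditional summability is the same as absolute
  convergence here, since the values lie in a finite-dimensional space.\<close>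

definition real_analytic_on :: "(real^'m \<Rightarrow> real^'n) \<Rightarrow> (real^'m) set \<Rightarrow> bool"
  where "real_analytic_on f W \<longleftrightarrow>
    (\<forall>p\<in>W. \<exists>r>0. \<exists>c :: ('m \<Rightarrow> nat) \<Rightarrow> real^'n. \<forall>y\<in>ball p r.
      ((\<lambda>\<alpha>. (\<Prod>i\<in>UNIV. (y$i - p$i) ^ \<alpha> i) *\<^sub>R c \<alpha>) has_sum f y) UNIV)"

text \<open>Local analytic parametrizations \<open>\<psi> : W \<rightarrow> M\<close>: analytic immersions that are homeomorphisms onto
  relatively open subsets of \<open>M\<close>. The values of \<open>\<psi>\<close> outside \<open>W\<close> are irrelevant.\<close>

definition analytic_parametrizations ::
    "(real^'n) set \<Rightarrow> ((real^'m \<Rightarrow> real^'n) \<times> (real^'m) set) set"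
  where "analytic_parametrizations M = {(\<psi>, W).
    open W \<and> real_analytic_on \<psi> W \<and>
    (\<forall>w\<in>W. inj (frechet_derivative \<psi> (at w))) \<and>
    openin (top_of_set M) (\<psi> ` W) \<and>
    (\<exists>g. homeomorphism W (\<psi> ` W) \<psi> g)}"

text \<open>Embedded submanifolds, not necessarily closed, of dimension \<open>CARD('m)\<close>. As index types are
  nonempty, the dimension is at least 1.\<close>

definition analytic_submanifold :: "('m::finite) itself \<Rightarrow> (real^'n) set \<Rightarrow> bool"
  where "analytic_submanifold (_ :: 'm::finite itself) M \<longleftrightarrow>
    (\<forall>p\<in>M. \<exists>(\<psi> :: real^'m \<Rightarrow> real^'n, W)\<in>analytic_parametrizations M. p \<in> \<psi> ` W)"

text \<open>The Riemannian volume in a parametrization \<open>\<psi>\<close> is the image of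
  \<open>\<surd>det(D\<psi>\<^sup>T D\<psi>)\<close> times Lebesgue measure, regarded as a measure on the whole of \<open>M\<close>.\<close>

definition chart_volume ::
    "(real^'n) set \<Rightarrow> (real^'m \<Rightarrow> real^'n) \<Rightarrow> (real^'m) set \<Rightarrow> (real^'n) measure"
  where "chart_volume M \<psi> W =
    distr
      (density (restrict_space lborel W)
        (\<lambda>w. ennreal (sqrt (det (transpose (jacobian \<psi> (at w)) ** jacobian \<psi> (at w))))))
      (restrict_space borel M) \<psi>"

text \<open>By change of variables \<open>chart_volume M \<psi> W\<close> is the restriction to \<open>\<psi> ` W\<close> of the volume measure
  of \<open>M\<close>; as the sets \<open>\<psi> ` W\<close> cover \<open>M\<close>, the volume measure is the supremum of these measures in the
  lattice of measures on \<open>M\<close>.\<close>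

definition submanifold_volume :: "('m::finite) itself \<Rightarrow> (real^'n) set \<Rightarrow> (real^'n) measure"
  where "submanifold_volume (_ :: 'm::finite itself) M =
    (SUP (\<psi> :: real^'m \<Rightarrow> real^'n, W)\<in>analytic_parametrizations M. chart_volume M \<psi> W)"


section \<open>The weighted flow and the lattices\<close>

text \<open>\<open>\<real>\<^sup>d\<close> is \<open>real ^ 'n option\<close> with \<open>d = CARD('n) + 1\<close>: the index \<open>None\<close> is the first coordinate, and
  \<open>Some j\<close>, for \<open>j\<close> in the order of \<open>'n\<close>, are the remaining \<open>d - 1\<close>. A \<open>1 \<times> (d - 1)\<close> matrix is an
  element of \<open>real ^ 'n\<close>.\<close>

definition weight_vector :: "real ^ ('n::{finite,linorder}) option \<Rightarrow> bool"
  where "weight_vector \<omega> \<longleftrightarrow>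
    \<omega> $ None = 1 \<and>
    (\<forall>i j. i \<le> j \<longrightarrow> \<omega> $ Some j \<le> \<omega> $ Some i) \<and>
    (\<forall>j. 0 < \<omega> $ Some j) \<and>
    (\<Sum>j\<in>UNIV. \<omega> $ Some j) = 1"

definition diag_flow :: "real ^ ('n::finite) option \<Rightarrow> real \<Rightarrow> real ^ 'n option ^ 'n option"
  where "diag_flow \<omega> t = (\<chi> i j. if i = j
    then (case i of None \<Rightarrow> exp (\<omega> $ i * t) | Some _ \<Rightarrow> exp (- \<omega> $ i * t)) else 0)"

definition unipotent :: "real ^ 'n \<Rightarrow> real ^ ('n::finite) option ^ 'n option"
  where "unipotent x = (\<chi> i j. if i = j then 1
    else (case (i, j) of (None, Some k) \<Rightarrow> x $ k | _ \<Rightarrow> 0))"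

definition integer_lattice :: "(real ^ 'd) set"
  where "integer_lattice = {v. \<forall>i. v $ i \<in> \<int>}"

definition lattice_of :: "real ^ 'n \<Rightarrow> (real ^ ('n::finite) option) set"
  where "lattice_of x = (\<lambda>v. unipotent x *v v) ` integer_lattice"


section \<open>Successive minima\<close>

definition unit_cube :: "(real ^ 'd) set"
  where "unit_cube = {v. \<forall>i. \<bar>v $ i\<bar> \<le> 1/2}"

definition successive_minimum :: "(real ^ 'd) set \<Rightarrow> nat \<Rightarrow> real"
  where "successive_minimum \<Lambda> i =
    (LEAST r. 0 < r \<and> (\<exists>S \<subseteq> \<Lambda> \<inter> (\<lambda>v. r *\<^sub>R v) ` unit_cube. independent S \<and> card S = i))"

definition log_minimum :: "real ^ ('n::finite) option \<Rightarrow> (real ^ 'n option) set \<Rightarrow> nat \<Rightarrow> real \<Rightarrow> real"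
  where "log_minimum \<omega> \<Lambda> i t =
    ln (successive_minimum ((\<lambda>v. diag_flow \<omega> t *v v) ` \<Lambda>) i)"

definition connected_at :: "real ^ ('n::finite) option \<Rightarrow> (real ^ 'n option) set \<Rightarrow> nat \<Rightarrow> bool"
  where "connected_at \<omega> \<Lambda> k \<longleftrightarrow>
    \<not> bdd_above {t. 0 \<le> t \<and> log_minimum \<omega> \<Lambda> k t = log_minimum \<omega> \<Lambda> (k + 1) t}"

definition connected_minima :: "real ^ ('n::finite) option \<Rightarrow> (real ^ 'n option) set \<Rightarrow> bool"
  where "connected_minima \<omega> \<Lambda> \<longleftrightarrow> (\<forall>k. 1 \<le> k \<and> k \<le> CARD('n option) - 1 \<longrightarrow> connected_at \<omega> \<Lambda> k)"

end

theory Submission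
  imports Defs "HOL-Complex_Analysis.Cauchy_Integral_Formula"
begin

text \<open>The conclusion holds for every \<open>x\<close> such that \<open>1, x\<^sub>1, \<dots>, x\<^sub>d\<^sub>-\<^sub>1\<close> are linearly independent over
  the rationals. These \<open>x\<close> have full measure in \<open>M\<close>: an affine function that does not vanish on \<open>M\<close>
  is not locally zero on \<open>M\<close> by analytic continuation, and then its zero set is null, because on every
  line through a point where it is nonzero its zeros are isolated.

  Let \<open>x\<close> be such a point, \<open>g\<^sub>t = a\<^sub>t u(x)\<close>, and suppose that \<open>L\<^sub>k < L\<^sub>k\<^sub>+\<^sub>1\<close> from some time on. Then the
  span \<open>V\<close> of the integer vectors realizing the first \<open>k\<close> minima of \<open>g\<^sub>t \<int>\<^sup>d\<close> is locally constant in \<open>t\<close>,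
  hence constant. As \<open>V\<close> is not contained in the hyperplane contracted by the flow, it has a complement spanned by
  vectors \<open>w\<^sub>j = u(- x) e\<^sub>j\<close> with \<open>j\<close> in a set \<open>J\<close>. For the minimal vectors \<open>v\<^sub>i\<close> at time \<open>t\<close> the
  determinant \<open>D\<^sub>t\<close> of the \<open>g\<^sub>t v\<^sub>i\<close> and the \<open>e\<^sub>j\<close> is \<open>exp (t \<Sum>\<^sub>J \<omega>\<^sub>j)\<close> times \<open>det (v, w)\<close>, which is bounded
  away from 0 by rationality of \<open>V\<close>; so \<open>D\<^sub>t\<close> tends to infinity. On the other hand, with \<open>r = \<lambda>\<^sub>k / 2\<close>, \<open>D\<^sub>t\<close>
  is at most a constant times \<open>r\<^sup>k\<close>, and Blichfeldt's principle bounds \<open>D\<^sub>t r\<^sup>d\<^sup>-\<^sup>k\<close>; so \<open>D\<^sub>t\<close> is bounded.\<close>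

section \<open>Minimal vectors of a lattice\<close>

lemma infnorm_le_iff_cart: "infnorm (x :: real^'d) \<le> c \<longleftrightarrow> (\<forall>i. \<bar>x $ i\<bar> \<le> c)"
proof
  assume "infnorm x \<le> c"
  then show "\<forall>i. \<bar>x $ i\<bar> \<le> c"
    using component_le_infnorm_cart[of x] by (meson order_trans)
next
  assume "\<forall>i. \<bar>x $ i\<bar> \<le> c"
  then show "infnorm x \<le> c"
    unfolding infnorm_cart by (intro cSup_least) auto
qed

text \<open>The source of the factor 2 in the later formulas for minima: the cube has side 1, hence
  half-width 1/2 in the sup norm.\<close>

lemma scaleR_unit_cube:
  assumes "0 < r"
  shows "(\<lambda>v. r *\<^sub>R v) ` unit_cube = {v :: real^'d. infnorm v \<le> r / 2}"
proof -
  have cube: "unit_cube = {v :: real^'d. infnorm v \<le> 1 / 2}"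
    unfolding infnorm_le_iff_cart unit_cube_def ..
  have "v \<in> (\<lambda>v. r *\<^sub>R v) ` unit_cube" if "infnorm v \<le> r / 2" for v :: "real^'d"
    using assms that by (intro image_eqI[of _ _ "(1 / r) *\<^sub>R v"]) (auto simp: cube infnorm_mul field_simps)
  then show ?thesis
    using assms by (auto simp: cube infnorm_mul)
qed

lemma countable_integer_lattice: "countable (integer_lattice :: (real^'d) set)"
proof (rule countable_subset)
  show "integer_lattice \<subseteq> (vec_lambda :: _ \<Rightarrow> real^'d) ` (PiE UNIV (\<lambda>_. \<int>))"
    by (auto simp: integer_lattice_def intro!: image_eqI[of _ _ "vec_nth a" for a])
  show "countable ((vec_lambda :: _ \<Rightarrow> real^'d) ` (PiE UNIV (\<lambda>_. \<int>)))"
    by (intro countable_image countable_PiE) (auto simp: countable_int)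
qed

lemma finite_integer_lattice_bounded: "finite {z \<in> (integer_lattice :: (real^'d) set). infnorm z \<le> R}"
proof (rule finite_subset)
  show "{z \<in> integer_lattice. infnorm z \<le> R} \<subseteq> (vec_lambda :: _ \<Rightarrow> real^'d) ` (PiE UNIV (\<lambda>_. {k \<in> \<int>. \<bar>k\<bar> \<le> R}))"
    by (auto simp: integer_lattice_def infnorm_le_iff_cart intro!: image_eqI[of _ _ "vec_nth a" for a])
  show "finite ((vec_lambda :: _ \<Rightarrow> real^'d) ` (PiE UNIV (\<lambda>_. {k \<in> \<int>. \<bar>k\<bar> \<le> R})))"
    by (intro finite_imageI finite_PiE) (auto simp: finite_abs_int_segment)
qed

lemma integer_lattice_diff:
  "x \<in> integer_lattice \<Longrightarrow> y \<in> integer_lattice \<Longrightarrow> x - y \<in> integer_lattice"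
  by (simp add: integer_lattice_def)

lemma axis_in_integer_lattice: "axis i 1 \<in> integer_lattice"
  by (simp add: integer_lattice_def axis_def)

lemma span_integer_lattice: "span (integer_lattice :: (real^'d) set) = UNIV"
proof -
  have "(Basis :: (real^'d) set) \<subseteq> integer_lattice"
    by (auto simp: Basis_vec_def axis_in_integer_lattice)
  then have "span Basis \<subseteq> span (integer_lattice :: (real^'d) set)"
    by (rule span_mono)
  then show ?thesis by auto
qed

text \<open>The inverse of \<open>g\<close> is bounded, so a bound on \<open>g *v z\<close> bounds
  \<open>z\<close>. This discreteness makes minima over lattice vectors attained.\<close>

lemma finite_integer_lattice_infnorm_image_le:
  fixes g :: "real^'d^'d"
  assumes "det g \<noteq> 0"
  shows "finite {z \<in> integer_lattice. infnorm (g *v z) \<le> R}"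
proof -
  obtain h where h: "h ** g = mat 1"
    using assms invertible_det_nz[of g] by (auto simp: invertible_def)
  obtain K where K: "\<And>v. norm (h *v v) \<le> norm v * K" "K > 0"
    using bounded_linear.pos_bounded[OF matrix_vector_mul_bounded_linear[of h]] by blast
  have "infnorm z \<le> sqrt DIM(real^'d) * R * K" if "infnorm (g *v z) \<le> R" for z
  proof -
    have "infnorm z \<le> norm (h *v (g *v z))"
      using infnorm_le_norm[of z] by (simp add: matrix_vector_mul_assoc h)
    also have "\<dots> \<le> norm (g *v z) * K"
      by (rule K)
    also have "\<dots> \<le> (sqrt DIM(real^'d) * infnorm (g *v z)) * K"
      using norm_le_infnorm[of "g *v z"] K by (intro mult_right_mono) auto
    also have "\<dots> \<le> (sqrt DIM(real^'d) * R) * K"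
      using that K by (intro mult_right_mono mult_left_mono) auto
    finally show ?thesis .
  qed
  then show ?thesis
    by (intro finite_subset[OF _ finite_integer_lattice_bounded[of "sqrt DIM(real^'d) * R * K"]]) auto
qed

lemma ex_integer_vector_not_in_span:
  fixes S :: "(real^'d) set"
  assumes "finite S" "card S < CARD('d)"
  shows "\<exists>y\<in>integer_lattice. y \<notin> span S"
proof (rule ccontr)
  assume "\<not> ?thesis"
  then have "span (integer_lattice :: (real^'d) set) \<subseteq> span S"
    by (intro span_minimal) auto
  then have "dim (UNIV :: (real^'d) set) \<le> card S"
    using assms(1) by (intro dim_le_card) (auto simp: span_integer_lattice)
  then show False
    using assms(2) by simp
qed

text \<open>A greedy choice of vectors realizing the successive minima. The vectors stay in the
  integer lattice and only their length is measured through \<open>g\<close>, so that choices for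
  different matrices can be compared. Counting starts at 0: \<open>z j\<close> belongs to the
  minimum number \<open>Suc j\<close>.\<close>

definition minimal_vectors :: "real^'d^'d \<Rightarrow> (nat \<Rightarrow> real^'d) \<Rightarrow> bool"
  where "minimal_vectors g z \<longleftrightarrow> (\<forall>j<CARD('d). z j \<in> integer_lattice \<and> z j \<notin> span (z ` {..<j}) \<and>
    (\<forall>y\<in>integer_lattice. y \<notin> span (z ` {..<j}) \<longrightarrow> infnorm (g *v z j) \<le> infnorm (g *v y)))"

lemma ex_minimal_vectors:
  fixes g :: "real^'d^'d"
  assumes "det g \<noteq> 0"
  shows "\<exists>z. minimal_vectors g z"
proof -
  have "\<exists>z. \<forall>j<n. z j \<in> integer_lattice \<and> z j \<notin> span (z ` {..<j}) \<and>
    (\<forall>y\<in>integer_lattice. y \<notin> span (z ` {..<j}) \<longrightarrow> infnorm (g *v z j) \<le> infnorm (g *v y))"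
    if "n \<le> CARD('d)" for n
    using that
  proof (induction n)
    case 0
    then show ?case by simp
  next
    case (Suc n)
    then obtain z where z: "\<forall>j<n. z j \<in> integer_lattice \<and> z j \<notin> span (z ` {..<j}) \<and>
        (\<forall>y\<in>integer_lattice. y \<notin> span (z ` {..<j}) \<longrightarrow> infnorm (g *v z j) \<le> infnorm (g *v y))"
      by auto
    define f where "f y = infnorm (g *v y)" for y
    have "card (z ` {..<n}) < CARD('d)"
      using card_image_le[of "{..<n}" z] Suc.prems by simp
    then obtain y0 where y0: "y0 \<in> integer_lattice" "y0 \<notin> span (z ` {..<n})"
      using ex_integer_vector_not_in_span[of "z ` {..<n}"] by auto
    \<comment> \<open>Only vectors at most as long as the candidate \<open>y0\<close> compete, which
      leaves a finite set.\<close>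
    define F where "F = {y \<in> integer_lattice. f y \<le> f y0} - span (z ` {..<n})"
    have "finite F"
      unfolding F_def f_def by (intro finite_Diff finite_integer_lattice_infnorm_image_le assms)
    moreover have "y0 \<in> F"
      using y0 by (simp add: F_def)
    ultimately obtain m where m: "m \<in> F" "\<And>y. y \<in> F \<Longrightarrow> f m \<le> f y"
      using arg_min_if_finite[of F f] by (metis empty_iff linorder_not_le)
    have min: "f m \<le> f y" if "y \<in> integer_lattice" "y \<notin> span (z ` {..<n})" for y
    proof (cases "f y \<le> f y0")
      case True
      then show ?thesis using m that by (simp add: F_def)
    next
      case False
      then show ?thesis using m(2)[OF \<open>y0 \<in> F\<close>] by linarith
    qed
    define z' where "z' = z(n := m)"
    have im: "z' ` {..<j} = z ` {..<j}" if "j \<le> n" for j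
      using that by (auto simp: z'_def)
    have "z' j \<in> integer_lattice \<and> z' j \<notin> span (z' ` {..<j}) \<and>
        (\<forall>y\<in>integer_lattice. y \<notin> span (z' ` {..<j}) \<longrightarrow> infnorm (g *v z' j) \<le> infnorm (g *v y))"
      if "j < Suc n" for j
    proof (cases "j = n")
      case True
      then show ?thesis
        using m min im[of n] by (auto simp: z'_def F_def f_def)
    next
      case False
      then show ?thesis
        using that z im[of j] by (auto simp: z'_def)
    qed
    then show ?case by blast
  qed
  then show ?thesis
    unfolding minimal_vectors_def by blast
qed

context
  fixes g :: "real^'d^'d" and z :: "nat \<Rightarrow> real^'d"
  assumes min: "minimal_vectors g z"
begin

lemma minimal_vectors_integer: "j < CARD('d) \<Longrightarrow> z j \<in> integer_lattice"
  and minimal_vectors_not_in_span: "j < CARD('d) \<Longrightarrow> z j \<notin> span (z ` {..<j})"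
  and minimal_vectors_le: "j < CARD('d) \<Longrightarrow> y \<in> integer_lattice \<Longrightarrow> y \<notin> span (z ` {..<j}) \<Longrightarrow>
    infnorm (g *v z j) \<le> infnorm (g *v y)"
  using min by (auto simp: minimal_vectors_def)

text \<open>The spans increase, so \<open>z j\<close> is already a competitor at step
  \<open>i\<close>.\<close>

lemma minimal_vectors_mono:
  assumes "i \<le> j" "j < CARD('d)"
  shows "infnorm (g *v z i) \<le> infnorm (g *v z j)"
proof (rule minimal_vectors_le)
  have "span (z ` {..<i}) \<subseteq> span (z ` {..<j})"
    using assms by (intro span_mono image_mono) auto
  then show "z j \<notin> span (z ` {..<i})"
    using minimal_vectors_not_in_span assms by blast
qed (use assms minimal_vectors_integer in auto)

lemma independent_minimal_vectors:
  assumes "n \<le> CARD('d)"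
  shows "independent (z ` {..<n})" and "card (z ` {..<n}) = n" and "inj_on z {..<n}"
proof -
  have "independent (z ` {..<n}) \<and> card (z ` {..<n}) = n"
    using assms
  proof (induction n)
    case (Suc n)
    then have *: "z n \<notin> span (z ` {..<n})"
      by (intro minimal_vectors_not_in_span) simp
    then have "z n \<notin> z ` {..<n}"
      using * span_base[of "z n" "z ` {..<n}"] by blast
    with * Suc show ?case
      by (simp add: lessThan_Suc independent_insertI)
  qed (simp add: independent_empty)
  then show "independent (z ` {..<n})" "card (z ` {..<n}) = n"
    by auto
  then show "inj_on z {..<n}"
    by (simp add: eq_card_imp_inj_on)
qed

text \<open>By the exchange lemma, since the span has dimension at most \<open>j\<close>. It serves
  to compare the greedy vectors with an arbitrary independent family, and later with the greedy
  vectors of another time.\<close>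

lemma ex_independent_not_in_span_minimal_vectors:
  assumes "independent S" "card S = Suc j"
  shows "\<exists>s\<in>S. s \<notin> span (z ` {..<j})"
proof (rule ccontr)
  assume "\<not> ?thesis"
  then have "S \<subseteq> span (z ` {..<j})"
    by blast
  then have "card S \<le> card (z ` {..<j})"
    using independent_span_bound[of "z ` {..<j}" S] assms(1) by simp
  also have "\<dots> \<le> j"
    using card_image_le[of "{..<j}" z] by simp
  finally show False
    using assms(2) by simp
qed

text \<open>The first \<open>Suc j\<close> greedy vectors show that this radius is admissible.
  Conversely, any \<open>Suc j\<close> independent lattice vectors include one outside the span of
  the first \<open>j\<close> greedy vectors, and that one is at least as long as
  \<open>z j\<close>.\<close>

lemma successive_minimum_minimal_vectors:
  assumes "det g \<noteq> 0" "j < CARD('d)"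
  shows "successive_minimum ((*v) g ` integer_lattice) (Suc j) = 2 * infnorm (g *v z j)"
    and "0 < infnorm (g *v z j)"
proof -
  have inj: "inj ((*v) g)"
    using assms(1) by (simp add: inj_matrix_vector_mult invertible_det_nz)
  have "z j \<noteq> 0"
    using minimal_vectors_not_in_span[OF assms(2)] span_zero by metis
  then show pos: "0 < infnorm (g *v z j)"
    using inj by (auto simp: infnorm_pos_lt dest: injD[of _ _ 0])
  show "successive_minimum ((*v) g ` integer_lattice) (Suc j) = 2 * infnorm (g *v z j)"
    unfolding successive_minimum_def
  proof (rule Least_equality, intro conjI exI)
    let ?S = "(*v) g ` z ` {..<Suc j}"
    show "0 < 2 * infnorm (g *v z j)"
      using pos by simp
    show "?S \<subseteq> (*v) g ` integer_lattice \<inter> (\<lambda>v. (2 * infnorm (g *v z j)) *\<^sub>R v) ` unit_cube"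
      using minimal_vectors_integer minimal_vectors_mono assms(2) pos
      by (subst scaleR_unit_cube) (auto simp: less_Suc_eq_le)
    show "independent ?S"
      using assms(2) inj independent_minimal_vectors(1)[of "Suc j"]
      by (intro linear_independent_injective_image) (auto intro: inj_on_subset)
    show "card ?S = Suc j"
      using assms(2) inj independent_minimal_vectors(2)[of "Suc j"]
      by (subst card_image) (auto intro: inj_on_subset)
  next
    fix r assume r_S: "0 < r \<and> (\<exists>S\<subseteq>(*v) g ` integer_lattice \<inter> (\<lambda>v. r *\<^sub>R v) ` unit_cube. independent S \<and> card S = Suc j)"
    then have r: "0 < r" ..
    from r_S have "\<exists>S\<subseteq>(*v) g ` integer_lattice \<inter> {v. infnorm v \<le> r / 2}. independent S \<and> card S = Suc j"
      unfolding scaleR_unit_cube[OF r] ..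
    then obtain S where S: "S \<subseteq> (*v) g ` integer_lattice \<inter> {v. infnorm v \<le> r / 2}"
      "independent S" "card S = Suc j"
      by (elim exE conjE)
    obtain S' where S': "S' \<subseteq> integer_lattice" "S = (*v) g ` S'"
      using S(1) by (meson le_infE subset_imageE)
    have "inj_on ((*v) g) S'"
      using inj by (rule inj_on_subset) simp
    then have "card S' = Suc j"
      using S(3) S'(2) by (simp add: card_image)
    \<comment> \<open>A linear dependence among the integer vectors would be carried by
      \<open>g\<close> to their images in \<open>S\<close>.\<close>
    moreover have "independent S'"
    proof
      assume "dependent S'"
      then obtain s where s: "s \<in> S'" "s \<in> span (S' - {s})"
        unfolding dependent_def by blast
      then have "g *v s \<in> (*v) g ` span (S' - {s})"
        by blast
      then have "g *v s \<in> span ((*v) g ` (S' - {s}))"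
        by (simp add: linear_span_image)
      moreover have "(*v) g ` (S' - {s}) = S - {g *v s}"
        using inj S'(2) by (auto dest: injD)
      moreover have "g *v s \<in> S"
        using s(1) S'(2) by blast
      ultimately have "dependent S"
        unfolding dependent_def by auto
      then show False
        using S(2) by contradiction
    qed
    ultimately obtain y where y: "y \<in> S'" "y \<notin> span (z ` {..<j})"
      using ex_independent_not_in_span_minimal_vectors by blast
    then have "infnorm (g *v z j) \<le> infnorm (g *v y)"
      using minimal_vectors_le[OF assms(2)] S'(1) by blast
    also have "\<dots> \<le> r / 2"
      using y S'(2) S(1) by auto
    finally show "2 * infnorm (g *v z j) \<le> r"
      by simp
  qed
qed

end


section \<open>Volume and determinant estimates\<close>

lemma emeasure_lebesgue_translation: "emeasure lebesgue ((+) a ` S) = emeasure lebesgue (S :: 'a::euclidean_space set)"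
  using emeasure_lebesgue_affine[of 1 a S] by (simp add: add.commute[of a] image_def)

text \<open>Cut \<open>K\<close> along the integer translates of a half-open unit cell and move all
  pieces into one cell. The hypothesis keeps the moved pieces disjoint, so their total volume is at
  most 1.\<close>

lemma Blichfeldt_integer_lattice:
  fixes K :: "(real^'d) set"
  assumes K: "K \<in> lmeasurable"
    and inj: "\<And>p q. p \<in> K \<Longrightarrow> q \<in> K \<Longrightarrow> p - q \<in> integer_lattice \<Longrightarrow> p = q"
  shows "measure lebesgue K \<le> 1"
proof -
  define cell where "cell z = {p :: real^'d. \<forall>i. z $ i \<le> p $ i \<and> p $ i < z $ i + 1}" for z
  define X where "X z = K \<inter> cell z" for z
  define Y where "Y z = (+) (- z) ` X z" for z
  have "cell z = (\<Inter>i. {p. p $ i \<ge> z $ i} \<inter> {p. p $ i < z $ i + 1})" for z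
    by (auto simp: cell_def)
  moreover have "(\<Inter>i. {p :: real^'d. p $ i \<ge> z $ i} \<inter> {p. p $ i < z $ i + 1}) \<in> sets borel" for z
    by (intro sets.finite_INT sets.Int borel_closed borel_open closed_halfspace_component_ge_cart
      open_halfspace_component_lt_cart) auto
  ultimately have cell: "cell z \<in> sets lebesgue" for z
    by simp
  have X: "X z \<in> lmeasurable" for z
    unfolding X_def using K cell by (intro fmeasurable_Int_fmeasurable) auto
  have Y: "Y z \<in> lmeasurable" for z
    unfolding Y_def using X by (rule measurable_translation)
  have disj_X: "disjoint_family_on X integer_lattice"
    unfolding disjoint_family_on_def
  proof (intro ballI impI)
    fix y z :: "real^'d" assume yz: "y \<in> integer_lattice" "z \<in> integer_lattice" "y \<noteq> z"
    have "y = z" if "p \<in> cell y" "p \<in> cell z" for p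
    proof -
      have "y $ i = z $ i" for i
      proof -
        have "y $ i \<in> \<int>" "z $ i \<in> \<int>"
          using yz by (simp_all add: integer_lattice_def)
        then obtain m n where mn: "y $ i = of_int m" "z $ i = of_int n"
          by (auto elim!: Ints_cases)
        have "y $ i \<le> p $ i" "p $ i < y $ i + 1" "z $ i \<le> p $ i" "p $ i < z $ i + 1"
          using that by (simp_all add: cell_def)
        then have "real_of_int m < real_of_int n + 1" "real_of_int n < real_of_int m + 1"
          unfolding mn by linarith+
        then have "m < n + 1" "n < m + 1"
          by linarith+
        then show ?thesis
          by (simp add: mn)
      qed
      then show ?thesis by (simp add: vec_eq_iff)
    qed
    then show "X y \<inter> X z = {}"
      using yz(3) by (auto simp: X_def)
  qed
  have disj_Y: "disjoint_family_on Y integer_lattice"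
    unfolding disjoint_family_on_def
  proof (intro ballI impI)
    fix y z :: "real^'d" assume yz: "y \<in> integer_lattice" "z \<in> integer_lattice" "y \<noteq> z"
    \<comment> \<open>Points of two pieces that meet after the translation differ by an integer
      vector, hence coincide; but the original pieces are disjoint.\<close>
    have False if p: "p \<in> X y" and q: "q \<in> X z" and "- y + p = - z + q" for p q
    proof -
      have "p - q = y - z"
        using that(3) by (simp add: algebra_simps)
      then have "p = q"
        using inj p q integer_lattice_diff[OF yz(1,2)] by (simp add: X_def)
      then show False
        using p q disj_X yz by (auto simp: disjoint_family_on_def)
    qed
    then show "Y y \<inter> Y z = {}"
      by (auto simp: Y_def)
  qed
  have "K = \<Union> (X ` integer_lattice)"
  proof -
    have "p \<in> cell (\<chi> i. of_int \<lfloor>p $ i\<rfloor>)" for p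
      by (simp add: cell_def)
    moreover have "(\<chi> i. of_int \<lfloor>p $ i\<rfloor>) \<in> integer_lattice" for p :: "real^'d"
      by (simp add: integer_lattice_def)
    ultimately show ?thesis
      unfolding X_def by blast
  qed
  then have "emeasure lebesgue K = (\<integral>\<^sup>+ z. emeasure lebesgue (X z) \<partial>count_space integer_lattice)"
    using emeasure_UN_countable[of integer_lattice X lebesgue] X countable_integer_lattice disj_X by auto
  also have "\<dots> = (\<integral>\<^sup>+ z. emeasure lebesgue (Y z) \<partial>count_space integer_lattice)"
    unfolding Y_def emeasure_lebesgue_translation ..
  also have "\<dots> = emeasure lebesgue (\<Union> (Y ` integer_lattice))"
    by (rule emeasure_UN_countable[symmetric]) (use Y countable_integer_lattice disj_Y in auto)
  also have "\<dots> \<le> emeasure lebesgue (cbox 0 (\<chi> i. 1) :: (real^'d) set)"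
  proof (rule emeasure_mono)
    show "\<Union> (Y ` integer_lattice) \<subseteq> cbox 0 (\<chi> i. 1)"
    proof -
      have "- z + p \<in> cbox 0 (\<chi> i. 1)" if "p \<in> X z" for z p
        unfolding mem_box_cart
      proof
        fix i
        have "z $ i \<le> p $ i" "p $ i < z $ i + 1"
          using that by (simp_all add: X_def cell_def)
        then show "0 $ i \<le> (- z + p) $ i \<and> (- z + p) $ i \<le> (\<chi> i. 1) $ i"
          by simp
      qed
      then show ?thesis
        unfolding Y_def by blast
    qed
  qed simp
  also have "\<dots> = 1"
  proof -
    have "cbox 0 (\<chi> i. 1) \<noteq> ({} :: (real^'d) set)"
      by (simp add: interval_ne_empty_cart)
    then show ?thesis
      using content_cbox_cart[of 0 "(\<chi> i. 1) :: real^'d"]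
      by (simp add: emeasure_eq_measure2)
  qed
  finally show ?thesis
    using K by (simp add: emeasure_eq_measure2)
qed

section \<open>Upper and lower bounds for determinants\<close>

lemma det_eq_0_if_row_in_span:
  fixes A :: "real^'d^'d"
  assumes "row i A \<in> span {row j A |j. j \<noteq> i}"
  shows "det A = 0"
proof -
  have "- row i A \<in> vec.span {row j A |j. j \<noteq> i}"
    using span_neg[OF assms] by (simp add: span_vec_eq)
  then have "det A = det (\<chi> k. if k = i then row i A + - row i A else row k A)"
    by (rule det_row_span[symmetric])
  also have "\<dots> = 0"
    by (rule det_zero_row(1)[of i]) (simp add: row_def vec_eq_iff)
  finally show ?thesis .
qed

text \<open>Applying \<open>transpose A\<close> to \<open>y\<close> forms the combination of the
  rows of \<open>A\<close> with coefficients \<open>y\<close>, so \<open>P\<close> is a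
  parallelepiped spanned by rows.\<close>

lemma measure_parallelepiped:
  fixes A :: "real^'d::{finite,wellorder}^'d::_"
  assumes "0 \<le> c"
  defines "P \<equiv> (*v) (transpose A) ` {y. \<forall>i. \<bar>y $ i\<bar> \<le> c}"
  shows "P \<in> lmeasurable" and "measure lebesgue P = \<bar>det A\<bar> * (2 * c) ^ CARD('d)"
proof -
  have abs_le: "\<bar>a\<bar> \<le> c \<longleftrightarrow> - c \<le> a \<and> a \<le> c" for a :: real
    by linarith
  have box: "{y :: real^'d::_. \<forall>i. \<bar>y $ i\<bar> \<le> c} = cbox (\<chi> i. - c) (\<chi> i. c)"
    by (simp add: set_eq_iff mem_box_cart abs_le)
  have "cbox (\<chi> i. - c) (\<chi> i. c) \<noteq> ({} :: (real^'d::_) set)"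
    using assms(1) by (simp add: interval_ne_empty_cart)
  then have vol: "measure lebesgue (cbox (\<chi> i. - c) (\<chi> i. c) :: (real^'d::_) set) = (2 * c) ^ CARD('d)"
    using content_cbox_cart[of "(\<chi> i. - c) :: real^'d::_" "\<chi> i. c"] by simp
  show "P \<in> lmeasurable"
    unfolding P_def box by (rule measurable_linear_image) auto
  have "measure lebesgue P = \<bar>det (matrix ((*v) (transpose A)))\<bar> * measure lebesgue (cbox (\<chi> i. - c) (\<chi> i. c) :: (real^'d::_) set)"
    unfolding P_def box by (rule measure_linear_image) auto
  then show "measure lebesgue P = \<bar>det A\<bar> * (2 * c) ^ CARD('d)"
    using vol by simp
qed

text \<open>Blichfeldt's principle is applied to a small multiple of the parallelepiped spanned by the rows of
  \<open>A\<close>: an integer vector that is a combination of the rows with small coefficients, the last nonzero one at row \<open>m\<close>, would be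
  shorter than row \<open>m\<close>, hence in the span of the preceding rows.\<close>

lemma det_minimal_vectors_le:
  fixes A g :: "real^'d::{finite,wellorder}^'d::_"
  assumes min: "minimal_vectors g z" and k: "k < CARD('d)"
    and h: "bij_betw h I {..k}"
    and rows_I: "\<And>i. i \<in> I \<Longrightarrow> A $ i = z (h i)"
    and rows: "\<And>i. i \<notin> I \<Longrightarrow> infnorm (g *v A $ i) = infnorm (g *v z k)"
    and g: "det g \<noteq> 0"
  shows "\<bar>det A\<bar> \<le> real (2 * CARD('d)) ^ CARD('d)"
proof (cases "det A = 0")
  case False
  \<comment> \<open>Differences of points of the parallelepiped have coefficients up to
    \<open>2 * c\<close>, and \<open>2 * c\<close> times the number of rows is 1/2, which makes
    combinations strictly shorter than their longest row.\<close>
  define c where "c = 1 / (4 * real CARD('d))"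
  have "0 \<le> c" by (simp add: c_def)
  have g_inj: "v = 0" if "g *v v = 0" for v
    using g that inj_matrix_vector_mult[of g] by (simp add: invertible_det_nz inj_on_def)
  define B where "B = {y :: real^'d::_. \<forall>i. \<bar>y $ i\<bar> \<le> c}"
  \<comment> \<open>\<open>lev\<close> orders the rows with those outside \<open>I\<close> last;
    \<open>idx i\<close> is the index of a minimal vector as long as row \<open>i\<close>, which is
    \<open>k\<close> for rows outside \<open>I\<close>.\<close>
  define lev where "lev i = (if i \<in> I then h i else Suc k)" for i
  define idx where "idx i = min (lev i) k" for i
  have idx_I: "idx i = h i" if "i \<in> I" for i
    using bij_betwE[OF h] that by (auto simp: idx_def lev_def)
  have idx_lt: "idx i < CARD('d)" for i
    using k by (auto simp: idx_def)
  have norm_row: "infnorm (g *v A $ i) = infnorm (g *v z (idx i))" for i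
    using rows_I rows idx_I by (cases "i \<in> I") (auto simp: idx_def lev_def)
  have comb: "transpose A *v y = (\<Sum>i\<in>UNIV. y $ i *\<^sub>R A $ i)" for y
    unfolding matrix_mult_sum by (simp add: scalar_mult_eq_scaleR row_def vec_lambda_eta)
  have "y = 0" if y: "\<And>i. \<bar>y $ i\<bar> \<le> 2 * c" and int: "transpose A *v y \<in> integer_lattice" for y :: "real^'d::_"
  proof (rule ccontr)
    assume "y \<noteq> 0"
    define \<gamma> where "\<gamma> = transpose A *v y"
    have "{i. y $ i \<noteq> 0} \<noteq> {}"
      using \<open>y \<noteq> 0\<close> by (auto simp: vec_eq_iff)
    \<comment> \<open>By the choice of \<open>m\<close>, every row that occurs in the combination
      has length at most \<open>R\<close>.\<close>
    then obtain m where m: "y $ m \<noteq> 0" "\<And>i. y $ i \<noteq> 0 \<Longrightarrow> lev i \<le> lev m"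
      using Max_in[of "lev ` {i. y $ i \<noteq> 0}"] Max_ge[of "lev ` {i. y $ i \<noteq> 0}"]
      by (smt (verit) finite finite_imageI image_iff image_is_empty mem_Collect_eq)
    define R where "R = infnorm (g *v z (idx m))"
    have "0 < R"
      using minimal_vectors_not_in_span[OF min idx_lt, of m] g_inj span_zero
      by (metis R_def infnorm_pos_lt)
    have row_le: "infnorm (g *v A $ i) \<le> R" if "y $ i \<noteq> 0" for i
      unfolding norm_row R_def
      using m(2)[OF that] idx_lt by (intro minimal_vectors_mono[OF min]) (auto simp: idx_def)
    have "g *v \<gamma> = (\<Sum>i\<in>UNIV. y $ i *\<^sub>R (g *v A $ i))"
      unfolding \<gamma>_def comb
      by (simp add: linear_sum[OF matrix_vector_mul_linear] matrix_vector_mult_scaleR)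
    have "infnorm (g *v \<gamma>) \<le> real CARD('d) * (2 * c * R)"
      unfolding infnorm_le_iff_cart
    proof
      fix j
      have "\<bar>(g *v \<gamma>) $ j\<bar> \<le> (\<Sum>i\<in>UNIV. \<bar>y $ i * (g *v A $ i) $ j\<bar>)"
        unfolding \<open>g *v \<gamma> = _\<close> by (simp add: sum_component)
      also have "\<dots> \<le> (\<Sum>i\<in>(UNIV :: 'd set). 2 * c * R)"
      proof (rule sum_mono)
        fix i
        show "\<bar>y $ i * (g *v A $ i) $ j\<bar> \<le> 2 * c * R"
        proof (cases "y $ i = 0")
          case False
          have "\<bar>(g *v A $ i) $ j\<bar> \<le> R"
            using component_le_infnorm_cart[of "g *v A $ i" j] row_le[OF False] by linarith
          then show ?thesis
            unfolding abs_mult using y[of i] \<open>0 \<le> c\<close> by (intro mult_mono) auto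
        qed (use \<open>0 \<le> c\<close> \<open>0 < R\<close> in auto)
      qed
      also have "\<dots> = real CARD('d) * (2 * c * R)"
        by simp
      finally show "\<bar>(g *v \<gamma>) $ j\<bar> \<le> real CARD('d) * (2 * c * R)" .
    qed
    also have "\<dots> < R"
      using \<open>0 < R\<close> by (simp add: c_def field_simps)
    \<comment> \<open>Minimality of \<open>z (idx m)\<close> excludes an integer vector shorter than
      \<open>R\<close> outside this span. The spanning vectors are rows other than
      \<open>m\<close>.\<close>
    finally have "\<gamma> \<in> span (z ` {..<idx m})"
      using minimal_vectors_le[OF min idx_lt, of \<gamma> m] int unfolding R_def \<gamma>_def by force
    moreover have "z ` {..<idx m} \<subseteq> {A $ i |i. i \<noteq> m}"
    proof safe
      fix l assume "l < idx m"
      moreover from this have "l \<in> {..k}"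
        by (simp add: idx_def)
      then obtain i where "i \<in> I" "l = h i"
        using h by (metis bij_betw_imp_surj_on imageE)
      moreover from calculation have "i \<noteq> m"
        using idx_I by auto
      ultimately show "\<exists>i. z l = A $ i \<and> i \<noteq> m"
        using rows_I by metis
    qed
    ultimately have "\<gamma> \<in> span {A $ i |i. i \<noteq> m}"
      using span_mono by blast
    moreover have "(\<Sum>i\<in>UNIV - {m}. y $ i *\<^sub>R A $ i) \<in> span {A $ i |i. i \<noteq> m}"
      by (intro span_sum span_scale span_base) auto
    \<comment> \<open>Solving for row \<open>m\<close> puts it into the span of the other rows,
      against \<open>det A\<close> being nonzero.\<close>
    moreover have "y $ m *\<^sub>R A $ m = \<gamma> - (\<Sum>i\<in>UNIV - {m}. y $ i *\<^sub>R A $ i)"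
      unfolding \<gamma>_def comb by (simp add: sum.remove[of UNIV m])
    ultimately have "y $ m *\<^sub>R A $ m \<in> span {A $ i |i. i \<noteq> m}"
      by (simp add: span_diff)
    then have "A $ m \<in> span {A $ i |i. i \<noteq> m}"
      using span_scale[of "y $ m *\<^sub>R A $ m" _ "1 / y $ m"] m(1) by simp
    then have "det A = 0"
      by (intro det_eq_0_if_row_in_span[of m]) (simp add: row_def vec_lambda_eta)
    with False show False by contradiction
  qed
  then have "p = q" if pq: "p \<in> (*v) (transpose A) ` B" "q \<in> (*v) (transpose A) ` B"
    and int: "p - q \<in> integer_lattice" for p q
  proof -
    obtain y y' where y: "p = transpose A *v y" "q = transpose A *v y'" "y \<in> B" "y' \<in> B"
      using pq by blast
    have "\<bar>(y - y') $ i\<bar> \<le> 2 * c" for i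
      using y(3,4) abs_triangle_ineq4[of "y $ i" "y' $ i"] by (auto simp: B_def dest!: spec[of _ i])
    moreover have "transpose A *v (y - y') \<in> integer_lattice"
      using int y(1,2) by (simp add: matrix_vector_mult_diff_distrib)
    ultimately have "y - y' = 0"
      using \<open>\<And>y. (\<And>i. \<bar>y $ i\<bar> \<le> 2 * c) \<Longrightarrow> transpose A *v y \<in> integer_lattice \<Longrightarrow> y = 0\<close> by blast
    then show ?thesis
      using y by simp
  qed
  then have "measure lebesgue ((*v) (transpose A) ` B) \<le> 1"
    unfolding B_def using measure_parallelepiped(1)[OF \<open>0 \<le> c\<close>]
    by (intro Blichfeldt_integer_lattice)
  then have "\<bar>det A\<bar> * (2 * c) ^ CARD('d) \<le> 1"
    unfolding B_def measure_parallelepiped(2)[OF \<open>0 \<le> c\<close>] .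
  moreover have "(2 * c) ^ CARD('d) = 1 / real (2 * CARD('d)) ^ CARD('d)"
    by (simp add: c_def power_divide)
  ultimately show ?thesis
    by (simp add: divide_le_eq)
qed simp

lemma abs_det_le:
  fixes A :: "real^'d^'d"
  assumes "\<And>i j. \<bar>A $ i $ j\<bar> \<le> b i"
  shows "\<bar>det A\<bar> \<le> fact CARD('d) * (\<Prod>i\<in>UNIV. b i)"
proof -
  have "\<bar>of_int (sign p) * (\<Prod>i\<in>UNIV. A $ i $ p i)\<bar> \<le> (\<Prod>i\<in>UNIV. b i)" for p
  proof -
    have "\<bar>of_int (sign p) * (\<Prod>i\<in>UNIV. A $ i $ p i)\<bar> = (\<Prod>i\<in>UNIV. \<bar>A $ i $ p i\<bar>)"
      by (simp add: abs_mult sign_def abs_prod)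
    also have "\<dots> \<le> (\<Prod>i\<in>UNIV. b i)"
      using assms by (intro prod_mono) auto
    finally show ?thesis .
  qed
  then have "\<bar>det A\<bar> \<le> (\<Sum>p | p permutes (UNIV :: 'd set). \<Prod>i\<in>UNIV. b i)"
    unfolding det_def by (intro order_trans[OF sum_abs] sum_mono)
  also have "\<dots> = fact CARD('d) * (\<Prod>i\<in>UNIV. b i)"
    by (simp add: card_permutations[OF refl])
  finally show ?thesis .
qed

lemma det_in_Ints:
  fixes A :: "real^'d^'d"
  assumes "\<And>i j. A $ i $ j \<in> \<int>"
  shows "det A \<in> \<int>"
  unfolding det_def using assms by (intro Ints_sum Ints_mult Ints_prod) auto

text \<open>On integer vectors \<open>u i\<close> in a rational subspace, \<open>det (u, w)\<close> takes values in a discrete set: it is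
  proportional to the integral form \<open>det (u, m)\<close> for any integral complement \<open>m\<close> of the subspace.\<close>

lemma det_bounded_below_on_rational_subspace:
  fixes w :: "'d \<Rightarrow> real^'d" and B :: "(real^'d) set" and I :: "'d set"
  assumes B: "independent (B \<union> w ` (- I))" "B \<inter> w ` (- I) = {}" "inj_on w (- I)" "card B = card I"
  obtains c where "0 < c"
    "\<And>u. \<lbrakk>\<And>i. i \<in> I \<Longrightarrow> u i \<in> span B \<inter> integer_lattice; independent (u ` I); inj_on u I\<rbrakk>
      \<Longrightarrow> c \<le> \<bar>det (\<chi> i. if i \<in> I then u i else w i)\<bar>"
proof -
  have "independent B"
    using B(1) independent_mono by blast
  then have "finite B"
    by (rule independent_imp_finite)
  \<comment> \<open>Extending \<open>B\<close> by standard basis vectors gives an integral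
    complement, whatever the real complement \<open>w\<close> is.\<close>
  obtain E where E: "B \<subseteq> E" "E \<subseteq> B \<union> Basis" "independent E" "B \<union> Basis \<subseteq> span E"
    using maximal_independent_subset_extend[of B "B \<union> Basis"] \<open>independent B\<close> by blast
  have "Basis \<subseteq> span E"
    using E(4) by blast
  then have "span Basis \<subseteq> span E"
    by (intro span_minimal) auto
  then have span_E: "span E = UNIV"
    by auto
  have "finite E"
    using E(3) by (rule independent_imp_finite)
  have "card E = CARD('d)"
    using dim_eq_card[of E UNIV] E(3) span_E by simp
  then have "card (E - B) = card (- I)"
    using E(1) \<open>finite B\<close> B(4) by (simp add: card_Diff_subset Compl_eq_Diff_UNIV)
  then obtain \<beta> where \<beta>: "bij_betw \<beta> (- I) (E - B)"
    using finite_same_card_bij[of "- I" "E - B"] \<open>finite E\<close> by auto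
  define f where "f v = (if v \<in> B then v else \<beta> (the_inv_into (- I) w v))" for v
  \<comment> \<open>\<open>P\<close> fixes the span of \<open>B\<close> and carries \<open>w\<close>
    to the integral complement, so passing from \<open>w\<close> to \<open>\<beta>\<close>
    multiplies the determinant by the constant \<open>det (matrix P)\<close>.\<close>
  obtain P where "linear P" and P: "\<forall>v\<in>B \<union> w ` (- I). P v = f v"
    using linear_independent_extend[OF B(1), of f] by auto
  have P_B: "P v = v" if "v \<in> span B" for v
    using that linear_eq_on_span[OF \<open>linear P\<close> linear_ident, of B] P by (simp add: f_def)
  have P_w: "P (w i) = \<beta> i" if "i \<notin> I" for i
  proof -
    have "w i \<notin> B"
      using B(2) that by blast
    then show ?thesis
      using that P B(3) by (simp add: f_def the_inv_into_f_f)
  qed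
  show thesis
  proof (rule that)
    \<comment> \<open>The summand 1 makes the constant positive with no need to discuss whether
      \<open>det (matrix P)\<close> vanishes.\<close>
    show "0 < 1 / (1 + \<bar>det (matrix P)\<bar>)"
      by (simp add: add_pos_nonneg)
    fix u :: "'d \<Rightarrow> real^'d"
    assume u: "\<And>i. i \<in> I \<Longrightarrow> u i \<in> span B \<inter> integer_lattice" "independent (u ` I)" "inj_on u I"
    define A where "A = (\<chi> i. if i \<in> I then u i else w i)"
    define Z where "Z = (\<chi> i. if i \<in> I then u i else \<beta> i)"
    have "P v = matrix P *v v" for v
      using \<open>linear P\<close> by (simp add: matrix_works linear_matrix_vector_mul_eq)
    then have "A ** transpose (matrix P) = (\<chi> i. P (A $ i))"
      by (simp add: vec_eq_iff matrix_matrix_mult_def transpose_def matrix_vector_mult_def mult.commute)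
    also have "\<dots> = Z"
      using u(1) P_B P_w by (simp add: A_def Z_def vec_eq_iff)
    finally have det_Z: "det Z = det A * det (matrix P)"
      by (metis det_mul det_transpose)
    have "\<beta> i \<in> integer_lattice" if "i \<notin> I" for i
    proof -
      have "\<beta> i \<in> Basis"
        using bij_betwE[OF \<beta>] that E(2) by blast
      then show ?thesis
        by (auto simp: Basis_vec_def axis_in_integer_lattice)
    qed
    then have "det Z \<in> \<int>"
      using u(1) by (intro det_in_Ints) (auto simp: Z_def integer_lattice_def)
    moreover have "det Z \<noteq> 0"
    proof -
      have "u ` I \<subseteq> span B"
        using u(1) by auto
      \<comment> \<open>The \<open>u i\<close> are as many independent vectors in the span of
        \<open>B\<close> as its dimension, so they span it, and the rows of \<open>Z\<close> span
        everything.\<close>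
      then have "span B \<subseteq> span (u ` I)"
        using card_ge_dim_independent[of "u ` I" "span B"] u(2,3) B(4) \<open>independent B\<close>
        by (simp add: card_image dim_eq_card_independent span_minimal)
      have row_Z: "Z $ i \<in> rows Z" for i
        by (auto simp: rows_def row_def vec_lambda_eta)
      have "u ` I \<subseteq> rows Z"
      proof safe
        fix i assume "i \<in> I"
        then show "u i \<in> rows Z"
          using row_Z[of i] by (simp add: Z_def)
      qed
      then have "B \<subseteq> span (rows Z)"
        using span_mono[of "u ` I" "rows Z"] span_superset[of B] \<open>span B \<subseteq> span (u ` I)\<close> by blast
      moreover have "E - B \<subseteq> rows Z"
      proof
        fix e assume "e \<in> E - B"
        then obtain i where "i \<notin> I" "e = \<beta> i"
          using \<beta> by (metis Compl_iff bij_betw_imp_surj_on imageE)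
        then show "e \<in> rows Z"
          using row_Z[of i] by (simp add: Z_def)
      qed
      ultimately have "E \<subseteq> span (rows Z)"
        using span_superset[of "rows Z"] by blast
      then have "span E \<subseteq> span (rows Z)"
        by (intro span_minimal) auto
      then have "span (rows Z) = UNIV"
        using span_E by auto
      then have "\<exists>Y. Y ** Z = mat 1"
        by (simp add: matrix_left_invertible_span_rows)
      then show ?thesis
        by (metis invertible_det_nz invertible_left_inverse)
    qed
    ultimately have "1 \<le> \<bar>det Z\<bar>"
      by (rule Ints_nonzero_abs_ge1)
    then have "1 \<le> \<bar>det A\<bar> * \<bar>det (matrix P)\<bar>"
      by (simp add: det_Z abs_mult)
    also have "\<dots> \<le> \<bar>det A\<bar> * (1 + \<bar>det (matrix P)\<bar>)"
      by (intro mult_left_mono) auto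
    finally show "1 / (1 + \<bar>det (matrix P)\<bar>) \<le> \<bar>det (\<chi> i. if i \<in> I then u i else w i)\<bar>"
      by (simp add: A_def divide_le_eq add_pos_nonneg)
  qed
qed


section \<open>Lattices under the weighted flow\<close>

text \<open>The library computes the volume of a parallelepiped in \<open>real^'d\<close> only for well-ordered \<open>'d\<close>.\<close>

instantiation option :: (linorder) linorder
begin

definition less_eq_option :: "'a option \<Rightarrow> 'a option \<Rightarrow> bool"
  where "less_eq_option x y \<longleftrightarrow>
    (case x of None \<Rightarrow> True | Some a \<Rightarrow> (case y of None \<Rightarrow> False | Some b \<Rightarrow> a \<le> b))"

definition less_option :: "'a option \<Rightarrow> 'a option \<Rightarrow> bool"
  where "less_option x y \<longleftrightarrow> x \<le> y \<and> \<not> y \<le> x"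

instance
  by standard (auto simp: less_eq_option_def less_option_def split: option.splits)

end

instance option :: ("{finite, linorder}") wellorder
proof
  fix P :: "'a option \<Rightarrow> bool" and a
  assume step: "\<And>x. (\<And>y. y < x \<Longrightarrow> P y) \<Longrightarrow> P x"
  show "P a"
  proof (induction "card {y. y < a}" arbitrary: a rule: less_induct)
    case less
    have "P y" if "y < a" for y
    proof (rule less)
      have "{x. x < y} \<subset> {x. x < a}"
        using that by (auto intro: less_trans)
      then show "card {x. x < y} < card {x. x < a}"
        by (intro psubset_card_mono) auto
    qed
    then show "P a"
      by (rule step)
  qed
qed

section \<open>Coordinates of the flow and growth of lengths\<close>

lemma sum_option_UNIV: "(\<Sum>i\<in>UNIV. f i) = f None + (\<Sum>j\<in>UNIV. f (Some j))"
  for f :: "'n::finite option \<Rightarrow> 'a::comm_monoid_add"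
  by (simp add: UNIV_option_conv sum.reindex)

lemma unipotent_mult_None:
  "(unipotent x *v v) $ None = v $ None + (\<Sum>j\<in>UNIV. x $ j * v $ Some j)"
  by (simp add: unipotent_def matrix_vector_mult_def sum_option_UNIV)

lemma unipotent_mult_Some: "(unipotent x *v v) $ Some j = v $ Some j"
proof -
  have "(unipotent x *v v) $ Some j = (\<Sum>i\<in>UNIV. if i = j then v $ Some i else 0)"
    by (simp add: unipotent_def matrix_vector_mult_def sum_option_UNIV if_distrib[of "\<lambda>c. c * _"] eq_commute cong: if_cong)
  then show ?thesis
    by simp
qed

text \<open>The inverse is \<open>unipotent (- x)\<close>.\<close>

lemma det_unipotent_nz: "det (unipotent x) \<noteq> 0"
proof -
  have "(unipotent x ** unipotent (- x)) *v v = v" for v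
  proof -
    have "(unipotent x *v (unipotent (- x) *v v)) $ i = v $ i" for i
      by (cases i) (simp_all add: unipotent_mult_None unipotent_mult_Some sum_negf)
    then show ?thesis
      by (simp add: vec_eq_iff flip: matrix_vector_mul_assoc)
  qed
  then have "unipotent x ** unipotent (- x) = mat 1"
    by (simp add: matrix_eq)
  then show ?thesis
    by (metis invertible_det_nz invertible_right_inverse)
qed

definition flow_exponent :: "real ^ ('n::finite) option \<Rightarrow> 'n option \<Rightarrow> real"
  where "flow_exponent \<omega> i = (case i of None \<Rightarrow> \<omega> $ i | Some _ \<Rightarrow> - \<omega> $ i)"

lemma diag_flow_eq: "diag_flow \<omega> t = (\<chi> i j. if i = j then exp (flow_exponent \<omega> i * t) else 0)"
  by (auto simp: diag_flow_def flow_exponent_def vec_eq_iff split: option.splits)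

lemma diag_flow_mult: "(diag_flow \<omega> t *v v) $ i = exp (flow_exponent \<omega> i * t) * v $ i"
  by (simp add: diag_flow_eq matrix_vector_mult_def if_distrib[of "\<lambda>c. c * _"] cong: if_cong)

lemma det_diag_flow:
  assumes "weight_vector \<omega>"
  shows "det (diag_flow \<omega> t) = 1"
proof -
  have "det (diag_flow \<omega> t) = (\<Prod>i\<in>UNIV. exp (flow_exponent \<omega> i * t))"
    by (subst det_diagonal) (simp_all add: diag_flow_eq)
  also have "\<dots> = exp (\<Sum>i\<in>UNIV. flow_exponent \<omega> i * t)"
    by (simp add: exp_sum)
  also have "(\<Sum>i\<in>UNIV. flow_exponent \<omega> i * t) = 0"
    using assms
    by (simp add: weight_vector_def sum_option_UNIV flow_exponent_def sum_negf flip: sum_distrib_right)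
  finally show ?thesis by simp
qed

lemma abs_flow_exponent_le:
  assumes "weight_vector \<omega>"
  shows "\<bar>flow_exponent \<omega> i\<bar> \<le> 1"
proof (cases i)
  case (Some j)
  have "\<omega> $ Some j \<le> (\<Sum>j\<in>UNIV. \<omega> $ Some j)"
    using assms by (intro member_le_sum) (auto simp: weight_vector_def less_imp_le)
  then show ?thesis
    using assms Some by (simp add: weight_vector_def flow_exponent_def less_imp_le)
qed (use assms in \<open>simp add: weight_vector_def flow_exponent_def\<close>)

text \<open>All exponents have absolute value at most 1, so each coordinate changes by a factor at
  most exp |t - s|. The bound is uniform in \<open>v\<close>, which lets all lattice vectors be
  controlled at once.\<close>

lemma infnorm_diag_flow_le:
  assumes "weight_vector \<omega>"
  shows "infnorm (diag_flow \<omega> t *v v) \<le> exp \<bar>t - s\<bar> * infnorm (diag_flow \<omega> s *v v)"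
  unfolding infnorm_le_iff_cart
proof
  fix i
  have "(diag_flow \<omega> t *v v) $ i = exp (flow_exponent \<omega> i * (t - s)) * (diag_flow \<omega> s *v v) $ i"
    by (simp add: diag_flow_mult algebra_simps flip: exp_add)
  then have "\<bar>(diag_flow \<omega> t *v v) $ i\<bar> = exp (flow_exponent \<omega> i * (t - s)) * \<bar>(diag_flow \<omega> s *v v) $ i\<bar>"
    by (simp add: abs_mult)
  also have "\<dots> \<le> exp \<bar>t - s\<bar> * infnorm (diag_flow \<omega> s *v v)"
  proof (rule mult_mono)
    have "flow_exponent \<omega> i * (t - s) \<le> \<bar>flow_exponent \<omega> i\<bar> * \<bar>t - s\<bar>"
      by (simp flip: abs_mult)
    also have "\<dots> \<le> 1 * \<bar>t - s\<bar>"
      using abs_flow_exponent_le[OF assms] by (rule mult_right_mono) simp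
    finally show "exp (flow_exponent \<omega> i * (t - s)) \<le> exp \<bar>t - s\<bar>"
      by simp
  qed (simp_all add: component_le_infnorm_cart)
  finally show "\<bar>(diag_flow \<omega> t *v v) $ i\<bar> \<le> exp \<bar>t - s\<bar> * infnorm (diag_flow \<omega> s *v v)" .
qed

abbreviation flow_matrix :: "real ^ ('n::finite) option \<Rightarrow> real ^ 'n \<Rightarrow> real \<Rightarrow> real ^ 'n option ^ 'n option"
  where "flow_matrix \<omega> x t \<equiv> diag_flow \<omega> t ** unipotent x"

lemma infnorm_flow_matrix_le:
  assumes "weight_vector \<omega>"
  shows "infnorm (flow_matrix \<omega> x t *v v) \<le> exp \<bar>t - s\<bar> * infnorm (flow_matrix \<omega> x s *v v)"
  using infnorm_diag_flow_le[OF assms] by (simp flip: matrix_vector_mul_assoc)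

lemma det_flow_matrix:
  assumes "weight_vector \<omega>"
  shows "det (flow_matrix \<omega> x t) = det (unipotent x)"
  using det_diag_flow[OF assms] by (simp add: det_mul)

lemma flow_lattice_of:
  "(\<lambda>v. diag_flow \<omega> t *v v) ` lattice_of x = (*v) (flow_matrix \<omega> x t) ` integer_lattice"
  unfolding lattice_of_def image_image by (simp add: matrix_vector_mul_assoc)

lemma log_minimum_eq:
  assumes "weight_vector \<omega>" "minimal_vectors (flow_matrix \<omega> x t) z" "j < CARD('n option)"
  shows "log_minimum \<omega> (lattice_of (x :: real ^ 'n::{finite,linorder})) (Suc j) t
      = ln (2 * infnorm (flow_matrix \<omega> x t *v z j))"
    and "0 < infnorm (flow_matrix \<omega> x t *v z j)"
proof -
  have "det (flow_matrix \<omega> x t) \<noteq> 0"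
    using det_flow_matrix[OF assms(1)] det_unipotent_nz by metis
  note * = successive_minimum_minimal_vectors[OF assms(2) this assms(3)]
  show "log_minimum \<omega> (lattice_of x) (Suc j) t = ln (2 * infnorm (flow_matrix \<omega> x t *v z j))"
    by (simp only: log_minimum_def flow_lattice_of *(1))
  show "0 < infnorm (flow_matrix \<omega> x t *v z j)"
    by (fact *(2))
qed

text \<open>Near time \<open>s\<close> lengths hardly change, so the first \<open>Suc k\<close>
  minimal vectors at time \<open>t\<close> are, at time \<open>s\<close>, still shorter than the
  next minimum. They therefore lie in the span for time \<open>s\<close>, and dimensions
  agree.\<close>

lemma minimal_subspace_locally_constant:
  fixes z :: "real \<Rightarrow> nat \<Rightarrow> real ^ ('n::{finite,linorder}) option"
  assumes \<omega>: "weight_vector \<omega>"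
    and min: "\<And>t. minimal_vectors (flow_matrix \<omega> x t) (z t)"
    and k: "Suc k < CARD('n option)"
    and gap: "infnorm (flow_matrix \<omega> x s *v z s k) < infnorm (flow_matrix \<omega> x s *v z s (Suc k))"
  obtains \<epsilon> where "0 < \<epsilon>" "\<And>t. \<bar>t - s\<bar> < \<epsilon> \<Longrightarrow> span (z t ` {..<Suc k}) = span (z s ` {..<Suc k})"
proof -
  define N where "N t v = infnorm (flow_matrix \<omega> x t *v v)" for t v
  have N_le: "N t v \<le> exp \<bar>t - s\<bar> * N s v" for s t v
    unfolding N_def by (rule infnorm_flow_matrix_le[OF \<omega>])
  define \<rho> where "\<rho> = N s (z s k)"
  define \<rho>' where "\<rho>' = N s (z s (Suc k))"
  have "0 \<le> \<rho>" "\<rho> < \<rho>'"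
    using gap by (simp_all add: \<rho>_def \<rho>'_def N_def infnorm_pos_le)
  have "((\<lambda>e. exp e * (exp e * \<rho>)) \<longlongrightarrow> exp 0 * (exp 0 * \<rho>)) (at_right 0)"
    by (intro tendsto_intros)
  \<comment> \<open>The factor \<open>exp e\<close> occurs twice: once for passing from
    \<open>s\<close> to \<open>t\<close>, once for passing back.\<close>
  then have "\<forall>\<^sub>F e in at_right 0. exp e * (exp e * \<rho>) < \<rho>'"
    using \<open>\<rho> < \<rho>'\<close> by (intro order_tendstoD) auto
  then obtain \<epsilon>0 where "0 < \<epsilon>0" "\<And>e. 0 < e \<Longrightarrow> e < \<epsilon>0 \<Longrightarrow> exp e * (exp e * \<rho>) < \<rho>'"
    unfolding eventually_at_right_field by auto
  then obtain \<epsilon> where \<epsilon>: "0 < \<epsilon>" "exp \<epsilon> * (exp \<epsilon> * \<rho>) < \<rho>'"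
    using dense by blast
  have "span (z t ` {..<Suc k}) = span (z s ` {..<Suc k})" if t: "\<bar>t - s\<bar> < \<epsilon>" for t
  proof -
    have "z t j \<in> span (z s ` {..<Suc k})" if j: "j < Suc k" for j
    proof (rule ccontr)
      assume "z t j \<notin> span (z s ` {..<Suc k})"
      then have "\<rho>' \<le> N s (z t j)"
        unfolding \<rho>'_def N_def using j k
        by (intro minimal_vectors_le[OF min] minimal_vectors_integer[OF min]) auto
      also have "\<dots> \<le> exp \<bar>s - t\<bar> * N t (z t j)"
        by (rule N_le)
      also have "N t (z t j) \<le> exp \<bar>t - s\<bar> * \<rho>"
      proof -
        \<comment> \<open>Some \<open>z s i\<close> among the first \<open>Suc j\<close> vectors at
          time \<open>s\<close> is a competitor for \<open>z t j\<close> at time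
          \<open>t\<close>.\<close>
        have "independent (z s ` {..<Suc j})" "card (z s ` {..<Suc j}) = Suc j"
          using independent_minimal_vectors[OF min, of "Suc j" s] j k by auto
        then obtain i where i: "i < Suc j" "z s i \<notin> span (z t ` {..<j})"
          using ex_independent_not_in_span_minimal_vectors[OF min, of "z s ` {..<Suc j}" j t] by auto
        have "N t (z t j) \<le> N t (z s i)"
          unfolding N_def using i j k
          by (intro minimal_vectors_le[OF min] minimal_vectors_integer[OF min]) auto
        also have "\<dots> \<le> exp \<bar>t - s\<bar> * N s (z s i)"
          by (rule N_le)
        also have "N s (z s i) \<le> \<rho>"
          unfolding \<rho>_def N_def using i j k by (intro minimal_vectors_mono[OF min]) auto
        finally show ?thesis by simp
      qed
      also have "exp \<bar>s - t\<bar> * (exp \<bar>t - s\<bar> * \<rho>) \<le> exp \<epsilon> * (exp \<epsilon> * \<rho>)"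
        using t \<open>0 \<le> \<rho>\<close> by (intro mult_mono) (auto simp: abs_minus_commute)
      finally show False
        using \<epsilon>(2) by simp
    qed
    then have "span (z t ` {..<Suc k}) \<subseteq> span (z s ` {..<Suc k})"
      by (intro span_minimal) auto
    moreover have "dim (span (z t ` {..<Suc k})) = dim (span (z s ` {..<Suc k}))"
      using independent_minimal_vectors[OF min, of "Suc k"] k by (simp add: dim_eq_card_independent)
    ultimately show ?thesis
      by (intro subspace_dim_equal) auto
  qed
  with \<epsilon>(1) show thesis
    by (rule that)
qed

text \<open>The \<open>w (Some j)\<close> are \<open>unipotent (- x)\<close> applied to standard
  basis vectors and span the hyperplane where the first coordinate of
  \<open>unipotent x *v v\<close> vanishes. As \<open>b\<close> lies outside it, \<open>B\<close>
  can be completed to a basis by some of them, without using \<open>w None\<close>.\<close>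

lemma ex_complement_in_unipotent_basis:
  fixes x :: "real ^ ('n::finite)" and B :: "(real ^ 'n option) set"
  defines "w \<equiv> \<lambda>i. axis i 1 - (case i of None \<Rightarrow> 0 | Some j \<Rightarrow> x $ j) *\<^sub>R axis None 1"
  assumes "independent B" and b: "b \<in> B" "(unipotent x *v b) $ None \<noteq> 0"
  obtains I where "None \<in> I" "independent (B \<union> w ` (- I))" "B \<inter> w ` (- I) = {}" "inj_on w (- I)" "card B = card I"
proof -
  define l where "l = (unipotent x *v b) $ None"
  define W where "W = range (\<lambda>j. w (Some j))"
  have inj_w: "inj (\<lambda>j. w (Some j))"
  proof
    fix i j assume "w (Some i) = w (Some j)"
    then have "w (Some i) $ Some i = w (Some j) $ Some i"
      by simp
    then show "i = j"
      by (simp add: w_def axis_def split: if_splits)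
  qed
  \<comment> \<open>Subtracting from \<open>b\<close> its components along the
    \<open>w (Some j)\<close> leaves a nonzero multiple of the expanding direction.\<close>
  have "l *\<^sub>R axis None 1 = b - (\<Sum>j\<in>UNIV. b $ Some j *\<^sub>R w (Some j))"
  proof -
    have w_None: "w (Some j) $ None = - x $ j" for j
      by (simp add: w_def axis_def)
    have w_Some: "w (Some j) $ Some i = (if j = i then 1 else 0)" for i j
      by (simp add: w_def axis_def)
    have "(l *\<^sub>R axis None 1) $ i = (b - (\<Sum>j\<in>UNIV. b $ Some j *\<^sub>R w (Some j))) $ i" for i
    proof (cases i)
      case None
      have "l = b $ None + (\<Sum>j\<in>UNIV. b $ Some j * x $ j)"
        by (simp add: l_def unipotent_mult_None mult.commute)
      then show ?thesis
        by (simp add: None w_None sum_negf)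
    next
      case (Some k)
      have "(\<Sum>j\<in>UNIV. b $ Some j * w (Some j) $ Some k) = (\<Sum>j\<in>UNIV. if j = k then b $ Some j else 0)"
        by (intro sum.cong refl) (simp add: w_Some)
      then show ?thesis
        by (simp add: Some axis_def)
    qed
    then show ?thesis by (simp add: vec_eq_iff)
  qed
  also have "\<dots> \<in> span (B \<union> W)"
    using b(1) by (intro span_diff span_sum span_scale) (auto intro: span_base simp: W_def)
  finally have None: "axis None 1 \<in> span (B \<union> W)"
    using span_scale[of "l *\<^sub>R axis None 1" "B \<union> W" "1 / l"] b(2) by (simp add: l_def)
  have "axis i 1 \<in> span (B \<union> W)" for i
  proof (cases i)
    case (Some j)
    have "axis i 1 = w (Some j) + x $ j *\<^sub>R axis None 1"
      by (simp add: Some w_def)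
    also have "\<dots> \<in> span (B \<union> W)"
      using None by (intro span_add span_scale) (auto intro: span_base simp: W_def)
    finally show ?thesis .
  qed (use None in simp)
  then have "Basis \<subseteq> span (B \<union> W)"
    by (auto simp: Basis_vec_def)
  then have "span Basis \<subseteq> span (B \<union> W)"
    by (rule span_minimal) simp
  then have span_BW: "span (B \<union> W) = UNIV"
    by auto
  obtain E where E: "B \<subseteq> E" "E \<subseteq> B \<union> W" "independent E" "B \<union> W \<subseteq> span E"
    using maximal_independent_subset_extend[of B "B \<union> W"] \<open>independent B\<close> by blast
  have "span (B \<union> W) \<subseteq> span E"
    using E(4) by (rule span_minimal) simp
  then have span_E: "span E = UNIV"
    using span_BW by auto
  have finE: "finite E" and finB: "finite B"
    using E(3) \<open>independent B\<close> by (auto intro: independent_imp_finite)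
  have cardE: "card E = CARD('n option)"
    using dim_eq_card[of E UNIV] E(3) span_E by simp
  define J where "J = Some ` {j. w (Some j) \<in> E - B}"
  have w_J: "w ` J = E - B"
    using E(2) by (auto simp: J_def W_def)
  have inj_J: "inj_on w J"
    using inj_w by (auto simp: J_def inj_on_def)
  have "card J = card (E - B)"
    using card_image[OF inj_J] w_J by simp
  then have "card B = card (- J)"
    using E(1) finB finE cardE card_mono[OF finE E(1)] by (simp add: card_Diff_subset Compl_eq_Diff_UNIV)
  moreover have "B \<union> w ` J = E" "B \<inter> w ` J = {}"
    using E(1) by (auto simp: w_J)
  moreover have "None \<in> - J"
    by (auto simp: J_def)
  ultimately show thesis
    using that[of "- J"] inj_J E(3) by simp
qed

text \<open>The contradiction comes from bounding \<open>exp (\<delta> * t)\<close> for all large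
  \<open>t\<close>, where \<open>\<delta>\<close> is a positive sum of weights. The lower bound for
  the determinant is the same in both cases; the upper bound depends on whether \<open>r\<close> is
  at least 1.\<close>

lemma minimal_subspace_not_eventually_constant:
  fixes \<omega> :: "real ^ ('n::{finite,linorder}) option" and x :: "real ^ 'n::{finite,linorder}"
  assumes \<omega>: "weight_vector \<omega>"
    and irrational: "\<And>v. v \<in> integer_lattice \<Longrightarrow> v \<noteq> 0 \<Longrightarrow> (unipotent x *v v) $ None \<noteq> 0"
    and min: "\<And>t. minimal_vectors (flow_matrix \<omega> x t) (z t)"
    and k: "Suc k < CARD('n option)"
    and V: "\<And>t. T < t \<Longrightarrow> span (z t ` {..<Suc k}) = V"
  shows False
proof -
  define w :: "'n option \<Rightarrow> real ^ 'n option"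
    where "w = (\<lambda>i. axis i 1 - (case i of None \<Rightarrow> 0 | Some j \<Rightarrow> x $ j) *\<^sub>R axis None 1)"
  define B where "B = z (T + 1) ` {..<Suc k}"
  have B: "independent B" "card B = Suc k" "span B = V"
    using independent_minimal_vectors[OF min, of "Suc k"] k V by (auto simp: B_def)
  have "z (T + 1) 0 \<in> integer_lattice" "z (T + 1) 0 \<noteq> 0"
    using minimal_vectors_integer[OF min, of 0] minimal_vectors_not_in_span[OF min, of 0] k by auto
  then have "(unipotent x *v z (T + 1) 0) $ None \<noteq> 0"
    by (rule irrational)
  moreover have "z (T + 1) 0 \<in> B"
    by (auto simp: B_def)
  ultimately obtain I where I: "None \<in> I" "independent (B \<union> w ` (- I))" "B \<inter> w ` (- I) = {}"
    "inj_on w (- I)" "card B = card I"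
    using ex_complement_in_unipotent_basis[OF B(1), of "z (T + 1) 0" x, folded w_def] by blast
  obtain c where c: "0 < c" "\<And>u. \<lbrakk>\<And>i. i \<in> I \<Longrightarrow> u i \<in> span B \<inter> integer_lattice; independent (u ` I); inj_on u I\<rbrakk>
      \<Longrightarrow> c \<le> \<bar>det (\<chi> i. if i \<in> I then u i else w i)\<bar>"
    using det_bounded_below_on_rational_subspace[OF I(2-5)] by blast
  obtain h where h: "bij_betw h I {..<Suc k}"
    using finite_same_card_bij[of I "{..<Suc k}"] I(5) B(2) by auto
  \<comment> \<open>The total contraction rate of the coordinates that complement the subspace. It
    is positive because the subspace is proper and \<open>None\<close> is in
    \<open>I\<close>.\<close>
  define \<delta> where "\<delta> = (\<Sum>i\<in>- I. \<omega> $ i)"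
  have \<omega>_pos: "0 < \<omega> $ i" if "i \<notin> I" for i
    using \<omega> I(1) that by (cases i) (auto simp: weight_vector_def)
  have "- I \<noteq> {}"
  proof
    assume "- I = {}"
    then have "I = UNIV" by auto
    then show False
      using I(5) B(2) k by simp
  qed
  then have "0 < \<delta>"
    unfolding \<delta>_def using \<omega>_pos by (intro sum_pos) auto
  define D where "D = \<bar>det (unipotent x)\<bar>"
  have "0 < D"
    using det_unipotent_nz by (simp add: D_def)
  define d where "d = CARD('n option)"
  \<comment> \<open>The two entries are the bounds from the cases \<open>1 \<le> r\<close> and
    \<open>r < 1\<close>.\<close>
  define K where "K = max (real (2 * d) ^ d / c) (fact d / (D * c))"
  have exp_le: "exp (\<delta> * t) \<le> K" if t: "T < t" for t
  proof -
    define g where "g = flow_matrix \<omega> x t"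
    define r where "r = infnorm (g *v z t k)"
    have det_g: "\<bar>det g\<bar> = D"
      unfolding g_def D_def det_flow_matrix[OF \<omega>] ..
    then have "det g \<noteq> 0"
      using \<open>0 < D\<close> by auto
    have "0 < r"
      unfolding r_def g_def using k by (intro log_minimum_eq(2)[OF \<omega> min]) simp
    define u where "u i = z t (h i)" for i
    have h_le: "h i \<le> k" if "i \<in> I" for i
      using bij_betwE[OF h] that by (simp add: less_Suc_eq_le)
    have u_im: "u ` I = z t ` {..<Suc k}"
      using h unfolding u_def by (metis bij_betw_imp_surj_on image_image)
    \<comment> \<open>Here the constancy of the span enters: \<open>c\<close> was obtained from the
      basis at time \<open>T + 1\<close> and serves all later times.\<close>
    have c_le: "c \<le> \<bar>det (\<chi> i. if i \<in> I then u i else w i)\<bar>"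
    proof (rule c(2))
      show "u i \<in> span B \<inter> integer_lattice" if "i \<in> I" for i
      proof
        have "u i \<in> span (u ` I)"
          using that by (intro span_base) simp
        then show "u i \<in> span B"
          using B(3) V[OF t] u_im by simp
        show "u i \<in> integer_lattice"
          using h_le[OF that] k unfolding u_def by (intro minimal_vectors_integer[OF min]) simp
      qed
      show "independent (u ` I)"
        unfolding u_im using independent_minimal_vectors(1)[OF min, of "Suc k"] k by simp
      show "inj_on u I"
        unfolding u_def using h independent_minimal_vectors(3)[OF min, of "Suc k" t] k
        by (auto simp: bij_betw_def intro: comp_inj_on[of h I "z t", unfolded o_def])
    qed
    \<comment> \<open>The scaling is such that \<open>g\<close> maps the rows outside
      \<open>I\<close> to \<open>s\<close> times standard basis vectors. Taking \<open>s = r\<close>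
      makes them as long as \<open>z t k\<close>, as \<open>det_minimal_vectors_le\<close> requires;
      \<open>s = 1\<close> is for the case of short vectors.\<close>
    define A where "A s = (\<chi> i. if i \<in> I then u i else (s * exp (\<omega> $ i * t)) *\<^sub>R w i)" for s
    have det_A: "c * (s ^ card (- I) * exp (\<delta> * t)) \<le> \<bar>det (A s)\<bar>" if "0 \<le> s" for s
    proof -
      have "A s = (\<chi> i. (if i \<in> I then 1 else s * exp (\<omega> $ i * t)) *s (if i \<in> I then u i else w i))"
        by (simp add: A_def vec_eq_iff)
      then have "det (A s) = (\<Prod>i\<in>UNIV. if i \<in> I then 1 else s * exp (\<omega> $ i * t)) *
          det (\<chi> i. if i \<in> I then u i else w i)"
        by (simp only: det_rows_mul)
      also have "(\<Prod>i\<in>UNIV. if i \<in> I then 1 else s * exp (\<omega> $ i * t)) = (\<Prod>i\<in>- I. s * exp (\<omega> $ i * t))"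
        by (simp add: prod.If_cases)
      also have "\<dots> = s ^ card (- I) * exp (\<delta> * t)"
        by (simp add: prod.distrib \<delta>_def sum_distrib_right exp_sum)
      finally have "\<bar>det (A s)\<bar> = (s ^ card (- I) * exp (\<delta> * t)) * \<bar>det (\<chi> i. if i \<in> I then u i else w i)\<bar>"
        using that by (simp add: abs_mult)
      then show ?thesis
        using c_le that by (simp add: mult.commute[of c] mult_left_mono)
    qed
    have g_u: "infnorm (g *v A s $ i) \<le> r" if "i \<in> I" for s i
      using that h_le[OF that] k unfolding r_def g_def
      by (simp add: A_def u_def minimal_vectors_mono[OF min])
    have g_w: "g *v A s $ i = s *\<^sub>R axis i 1" if i: "i \<notin> I" for s i
    proof -
      obtain j where j: "i = Some j"
        using i I(1) by (cases i) auto
      have "unipotent x *v w i = axis i 1"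
      proof -
        have "(unipotent x *v w i) $ l = axis i 1 $ l" for l
          by (cases l) (auto simp: unipotent_mult_None unipotent_mult_Some w_def j axis_def
              if_distrib[of "\<lambda>c. _ * c"] cong: if_cong)
        then show ?thesis by (simp add: vec_eq_iff)
      qed
      moreover have "diag_flow \<omega> t *v axis i 1 = exp (- (\<omega> $ i * t)) *\<^sub>R axis i 1"
        by (simp add: vec_eq_iff diag_flow_mult flow_exponent_def j axis_def)
      ultimately have "g *v w i = exp (- (\<omega> $ i * t)) *\<^sub>R axis i 1"
        by (simp add: g_def flip: matrix_vector_mul_assoc)
      then show ?thesis
        using that by (simp add: A_def matrix_vector_mult_scaleR exp_minus)
    qed
    have infnorm_axis: "infnorm (axis i 1 :: real ^ 'n option) = 1" for i
    proof (rule antisym)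
      show "infnorm (axis i 1 :: real ^ 'n option) \<le> 1"
        by (simp add: infnorm_le_iff_cart axis_def)
      show "1 \<le> infnorm (axis i 1 :: real ^ 'n option)"
        using component_le_infnorm_cart[of "axis i 1 :: real ^ 'n option" i] by simp
    qed
    show ?thesis
    proof (cases "1 \<le> r")
      case True
      have "\<bar>det (A r)\<bar> \<le> real (2 * CARD('n option)) ^ CARD('n option)"
      proof (rule det_minimal_vectors_le[OF min])
        show "k < CARD('n option)" using k by simp
        show "bij_betw h I {..k}" using h by (simp add: lessThan_Suc_atMost)
        show "A r $ i = z t (h i)" if "i \<in> I" for i
          using that by (simp add: A_def u_def)
        show "infnorm (flow_matrix \<omega> x t *v A r $ i) = infnorm (flow_matrix \<omega> x t *v z t k)" if "i \<notin> I" for i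
          using g_w[OF that, of r] \<open>0 < r\<close>
          by (simp add: g_def[symmetric] r_def[symmetric] infnorm_mul infnorm_axis)
        show "det (flow_matrix \<omega> x t) \<noteq> 0"
          using \<open>det g \<noteq> 0\<close> by (simp add: g_def)
      qed
      moreover have "c * exp (\<delta> * t) \<le> c * (r ^ card (- I) * exp (\<delta> * t))"
        using True c(1) by (simp add: mult_left_mono one_le_power)
      ultimately have "c * exp (\<delta> * t) \<le> real (2 * d) ^ d"
        using det_A[of r] \<open>0 < r\<close> unfolding d_def by linarith
      then have "exp (\<delta> * t) \<le> real (2 * d) ^ d / c"
        using c(1) by (simp add: field_simps)
      then show ?thesis
        unfolding K_def by linarith
    next
      case False
      \<comment> \<open>All minimal vectors in question are shorter than 1 and the other rows go to
        unit vectors, so the Leibniz formula alone bounds the determinant.\<close>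
      have "\<bar>(A 1 ** transpose g) $ i $ j\<bar> \<le> 1" for i j
      proof -
        have "(A 1 ** transpose g) $ i $ j = (g *v A 1 $ i) $ j"
          by (simp add: matrix_matrix_mult_def transpose_def matrix_vector_mult_def mult.commute)
        moreover have "infnorm (g *v A 1 $ i) \<le> 1"
          using g_u[of i 1] g_w[of i 1] False infnorm_axis by (cases "i \<in> I") auto
        ultimately show ?thesis
          by (metis component_le_infnorm_cart order_trans)
      qed
      then have "\<bar>det (A 1 ** transpose g)\<bar> \<le> fact CARD('n option) * (\<Prod>i\<in>(UNIV :: 'n option set). 1)"
        by (rule abs_det_le)
      then have "\<bar>det (A 1)\<bar> * D \<le> fact d"
        by (simp add: det_mul abs_mult det_g d_def)
      moreover have "c * exp (\<delta> * t) * D \<le> \<bar>det (A 1)\<bar> * D"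
        using det_A[of 1] \<open>0 < D\<close> by (simp add: mult_right_mono)
      ultimately have "exp (\<delta> * t) * (D * c) \<le> fact d"
        by (simp add: mult_ac)
      then have "exp (\<delta> * t) \<le> fact d / (D * c)"
        using c(1) \<open>0 < D\<close> by (simp add: pos_le_divide_eq)
      then show ?thesis
        unfolding K_def by linarith
    qed
  qed
  define t where "t = max (T + 1) (K / \<delta>)"
  have "K \<le> \<delta> * t"
    using \<open>0 < \<delta>\<close> by (simp add: t_def field_simps max_def)
  moreover have "1 + \<delta> * t \<le> exp (\<delta> * t)"
    by (rule exp_ge_add_one_self)
  moreover have "exp (\<delta> * t) \<le> K"
    by (rule exp_le) (simp add: t_def)
  ultimately show False
    by linarith
qed

text \<open>If two consecutive minima differ from some time on, the span of the earlier minimal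
  vectors is locally constant on a ray, hence constant there by connectedness, which the preceding
  lemma excludes.\<close>

lemma connected_minima_if_irrational:
  fixes \<omega> :: "real ^ ('n::{finite,linorder}) option" and x :: "real ^ 'n::{finite,linorder}"
  assumes \<omega>: "weight_vector \<omega>"
    and irrational: "\<And>v. v \<in> integer_lattice \<Longrightarrow> v \<noteq> 0 \<Longrightarrow> (unipotent x *v v) $ None \<noteq> 0"
  shows "connected_minima \<omega> (lattice_of x)"
  unfolding connected_minima_def
proof (intro allI impI)
  fix k' assume "1 \<le> k' \<and> k' \<le> CARD('n option) - 1"
  then obtain k where k': "k' = Suc k" and k: "Suc k < CARD('n option)"
    by (cases k') auto
  have "\<exists>z. \<forall>t. minimal_vectors (flow_matrix \<omega> x t) (z t)"
  proof (intro choice allI ex_minimal_vectors)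
    show "det (flow_matrix \<omega> x t) \<noteq> 0" for t
      using det_flow_matrix[OF \<omega>] det_unipotent_nz by metis
  qed
  then obtain z where min: "\<And>t. minimal_vectors (flow_matrix \<omega> x t) (z t)"
    by blast
  show "connected_at \<omega> (lattice_of x) k'"
    unfolding connected_at_def
  proof
    assume "bdd_above {t. 0 \<le> t \<and> log_minimum \<omega> (lattice_of x) k' t = log_minimum \<omega> (lattice_of x) (k' + 1) t}"
    then obtain T0 where T0: "\<And>t. 0 \<le> t \<Longrightarrow>
        log_minimum \<omega> (lattice_of x) k' t = log_minimum \<omega> (lattice_of x) (k' + 1) t \<Longrightarrow> t \<le> T0"
      unfolding bdd_above_def by blast
    define T where "T = max 0 T0"
    have gap: "infnorm (flow_matrix \<omega> x s *v z s k) < infnorm (flow_matrix \<omega> x s *v z s (Suc k))"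
      if "T < s" for s
    proof -
      have "log_minimum \<omega> (lattice_of x) k' s \<noteq> log_minimum \<omega> (lattice_of x) (k' + 1) s"
        using T0[of s] that by (auto simp: T_def)
      then have "infnorm (flow_matrix \<omega> x s *v z s k) \<noteq> infnorm (flow_matrix \<omega> x s *v z s (Suc k))"
        using log_minimum_eq(1)[OF \<omega> min, of k s] log_minimum_eq(1)[OF \<omega> min, of "Suc k" s] k k' by auto
      moreover have "infnorm (flow_matrix \<omega> x s *v z s k) \<le> infnorm (flow_matrix \<omega> x s *v z s (Suc k))"
        using minimal_vectors_mono[OF min, of k "Suc k"] k by simp
      ultimately show ?thesis by simp
    qed
    have "(\<lambda>t. span (z t ` {..<Suc k})) constant_on {T<..}"
    proof (rule locally_constant_imp_constant)
      show "connected {T<..}"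
        by (rule connected_Ioi)
    next
      fix s assume "s \<in> {T<..}"
      then obtain \<epsilon> where \<epsilon>: "0 < \<epsilon>"
        "\<And>t. \<bar>t - s\<bar> < \<epsilon> \<Longrightarrow> span (z t ` {..<Suc k}) = span (z s ` {..<Suc k})"
        using minimal_subspace_locally_constant[OF \<omega> min k gap[of s]] unfolding greaterThan_iff by blast
      then show "\<exists>U. openin (top_of_set {T<..}) U \<and> s \<in> U \<and>
          (\<forall>t\<in>U. span (z t ` {..<Suc k}) = span (z s ` {..<Suc k}))"
      proof (intro exI[of _ "{T<..} \<inter> ball s \<epsilon>"] conjI ballI)
        show "openin (top_of_set {T<..}) ({T<..} \<inter> ball s \<epsilon>)"
          by (rule openin_open_Int) simp
        show "s \<in> {T<..} \<inter> ball s \<epsilon>"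
          using \<open>s \<in> {T<..}\<close> \<epsilon>(1) by simp
        show "span (z t ` {..<Suc k}) = span (z s ` {..<Suc k})" if "t \<in> {T<..} \<inter> ball s \<epsilon>" for t
          by (rule \<epsilon>(2)) (use that in \<open>simp add: dist_real_def abs_minus_commute\<close>)
      qed
    qed
    then obtain V where V: "\<forall>t\<in>{T<..}. span (z t ` {..<Suc k}) = V"
      unfolding constant_on_def by blast
    show False
      by (rule minimal_subspace_not_eventually_constant[OF \<omega> irrational min k, of T V]) (use V in simp_all)
  qed
qed


section \<open>Null sets on analytic submanifolds\<close>

lemma finite_multi_indices_of_degree:
  "finite {\<alpha> :: 'm::finite \<Rightarrow> nat. sum \<alpha> UNIV = n}"
proof -
  have "{\<alpha> :: 'm \<Rightarrow> nat. sum \<alpha> UNIV = n} \<subseteq> PiE UNIV (\<lambda>_. {..n})"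
    by (auto intro: member_le_sum)
  then show ?thesis
    by (rule finite_subset) (simp add: finite_PiE)
qed

text \<open>Group the multi-indices by total degree \<open>n\<close>: homogeneity extracts
  \<open>h ^ n\<close> from each finite group.\<close>

lemma has_sum_multi_index_imp_sums:
  fixes c :: "('m::finite \<Rightarrow> nat) \<Rightarrow> real"
  assumes "((\<lambda>\<alpha>. (\<Prod>i\<in>UNIV. (h * v i) ^ \<alpha> i) * c \<alpha>) has_sum s) UNIV"
  shows "(\<lambda>n. (\<Sum>\<alpha> | sum \<alpha> UNIV = n. (\<Prod>i\<in>UNIV. v i ^ \<alpha> i) * c \<alpha>) * h ^ n) sums s"
proof -
  define f where "f = (\<lambda>\<alpha>. (\<Prod>i\<in>UNIV. (h * v i) ^ \<alpha> i) * c \<alpha>)"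
  define D where "D n = {\<alpha> :: 'm \<Rightarrow> nat. sum \<alpha> UNIV = n}" for n
  have UNIV_eq: "UNIV = snd ` Sigma UNIV D"
    by (force simp: D_def)
  have "inj_on snd (Sigma UNIV D)"
    by (auto simp: inj_on_def D_def)
  then have "((f \<circ> snd) has_sum s) (Sigma UNIV D)"
    using assms has_sum_reindex[of snd "Sigma UNIV D" f s] by (simp add: f_def UNIV_eq[symmetric])
  moreover have "((\<lambda>\<alpha>. (f \<circ> snd) (n, \<alpha>)) has_sum sum f (D n)) (D n)" for n
    using finite_multi_indices_of_degree[of n] by (auto simp: D_def intro!: has_sum_finiteI)
  ultimately have "((\<lambda>n. sum f (D n)) has_sum s) UNIV"
    by (rule has_sum_Sigma')
  moreover have "sum f (D n) = (\<Sum>\<alpha> | sum \<alpha> UNIV = n. (\<Prod>i\<in>UNIV. v i ^ \<alpha> i) * c \<alpha>) * h ^ n" for n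
  proof -
    have "f \<alpha> = ((\<Prod>i\<in>UNIV. v i ^ \<alpha> i) * c \<alpha>) * h ^ n" if "\<alpha> \<in> D n" for \<alpha>
      using that by (auto simp: f_def D_def power_mult_distrib prod.distrib power_sum[symmetric])
    then have "sum f (D n) = (\<Sum>\<alpha>\<in>D n. ((\<Prod>i\<in>UNIV. v i ^ \<alpha> i) * c \<alpha>) * h ^ n)"
      by (rule sum.cong[OF refl])
    then show ?thesis
      by (simp add: sum_distrib_right D_def)
  qed
  ultimately show ?thesis
    using has_sum_imp_sums by simp
qed

lemma real_analytic_on_line:
  fixes \<psi> :: "real^'m \<Rightarrow> real^'n"
  assumes "real_analytic_on \<psi> W" "q + s0 *\<^sub>R v \<in> W"
  obtains \<epsilon> c where "0 < \<epsilon>"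
    "\<And>s. \<bar>s - s0\<bar> < \<epsilon> \<Longrightarrow> (\<lambda>n. c n * (s - s0) ^ n) sums (a \<bullet> \<psi> (q + s *\<^sub>R v) - b)"
proof -
  define p where "p = q + s0 *\<^sub>R v"
  obtain r c where "0 < r" and
    c: "\<And>y. y \<in> ball p r \<Longrightarrow>
      ((\<lambda>\<alpha>. (\<Prod>i\<in>UNIV. (y$i - p$i) ^ \<alpha> i) *\<^sub>R c \<alpha>) has_sum \<psi> y) UNIV"
    using assms unfolding real_analytic_on_def p_def by blast
  define e where "e n = (\<Sum>\<alpha> | sum \<alpha> UNIV = n. (\<Prod>i\<in>UNIV. (v$i) ^ \<alpha> i) * (a \<bullet> c \<alpha>))" for n
  show thesis
  proof (rule that)
    \<comment> \<open>The summand 1 covers \<open>v = 0\<close>.\<close>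
    show "0 < r / (1 + norm v)"
      using \<open>0 < r\<close> by (simp add: add_pos_nonneg)
    fix s :: real
    assume s: "\<bar>s - s0\<bar> < r / (1 + norm v)"
    have "\<bar>s - s0\<bar> * norm v \<le> \<bar>s - s0\<bar> * (1 + norm v)"
      by (intro mult_left_mono) auto
    also have "\<dots> < r"
      using s by (simp add: pos_less_divide_eq add_pos_nonneg)
    finally have "norm ((s0 - s) *\<^sub>R v) < r"
      by (simp add: abs_minus_commute)
    then have "q + s *\<^sub>R v \<in> ball p r"
      by (simp add: p_def dist_norm algebra_simps)
    from has_sum_bounded_linear[OF bounded_linear_inner_right c[OF this], of a]
    have "((\<lambda>\<alpha>. (\<Prod>i\<in>UNIV. ((s - s0) * v$i) ^ \<alpha> i) * (a \<bullet> c \<alpha>)) has_sum (a \<bullet> \<psi> (q + s *\<^sub>R v))) UNIV"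
      by (simp add: p_def algebra_simps o_def)
    then have "(\<lambda>n. e n * (s - s0) ^ n) sums (a \<bullet> \<psi> (q + s *\<^sub>R v))"
      unfolding e_def by (rule has_sum_multi_index_imp_sums)
    moreover have "(\<lambda>n. (if n = 0 then b else 0) * (s - s0) ^ n) sums b"
      using sums_single[of 0 "\<lambda>n. b * (s - s0) ^ n"] by (simp add: if_distrib[of "\<lambda>x. x * _"] cong: if_cong)
    ultimately show "(\<lambda>n. (e n - (if n = 0 then b else 0)) * (s - s0) ^ n) sums (a \<bullet> \<psi> (q + s *\<^sub>R v) - b)"
      using sums_diff by (fastforce simp: left_diff_distrib)
  qed
qed

text \<open>The two alternatives correspond to whether all coefficients vanish.\<close>

lemma power_series_isolated_zeros:
  fixes g :: "real \<Rightarrow> real"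
  assumes "0 < r" and sums: "\<And>s. \<bar>s - s0\<bar> < r \<Longrightarrow> (\<lambda>n. c n * (s - s0) ^ n) sums g s"
  shows "(\<forall>\<^sub>F s in nhds s0. g s = 0) \<or> (\<forall>\<^sub>F s in at s0. g s \<noteq> 0)"
proof (cases "\<forall>n. c n = 0")
  case True
  have "g s = 0" if "dist s s0 < r" for s
    using sums[of s] that True sums_unique2[OF _ sums_zero] by (simp add: dist_real_def)
  then show ?thesis
    using \<open>0 < r\<close> by (auto simp: eventually_nhds_metric)
next
  case False
  then obtain m where m: "c m \<noteq> 0"
    by blast
  \<comment> \<open>Multiplying by \<open>s - s0\<close> forces the value 0 at \<open>s0\<close>, as the cited lemma requires.\<close>
  define c' where "c' = (\<lambda>n. case n of 0 \<Rightarrow> 0 | Suc k \<Rightarrow> c k)"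
  have "(\<lambda>n. c' n * (s - s0) ^ n) sums ((s - s0) * g s)" if "norm (s - s0) < r" for s
  proof -
    have "(\<lambda>n. c' (Suc n) * (s - s0) ^ Suc n) sums ((s - s0) * g s)"
      using sums_mult[OF sums, of s "s - s0"] that by (simp add: c'_def mult_ac)
    then show ?thesis
      using sums_Suc_iff[of "\<lambda>n. c' n * (s - s0) ^ n"] by (simp add: c'_def)
  qed
  then obtain s where "0 < s" "\<And>z. z \<in> cball s0 s - {s0} \<Longrightarrow> (z - s0) * g z \<noteq> 0"
    using powser_0_nonzero[OF \<open>0 < r\<close>, where m="Suc m" and f="\<lambda>s. (s - s0) * g s"
        and a=c' and \<xi>=s0] m
    by (auto simp: c'_def)
  then have "\<forall>\<^sub>F z in at s0. g z \<noteq> 0"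
    unfolding eventually_at by (intro exI[of _ s]) (auto simp: dist_commute)
  then show ?thesis ..
qed

text \<open>Both alternatives in \<open>isolated\<close> hold on open sets and exclude each other.
  As \<open>T\<close> is connected and \<open>t0\<close> satisfies the second, the second holds
  throughout, and the zeros form a discrete set.\<close>

lemma negligible_zeros_on_line:
  fixes g :: "real \<Rightarrow> real"
  assumes "open T" "connected T" "t0 \<in> T" "g t0 \<noteq> 0"
    and isolated: "\<And>t. t \<in> T \<Longrightarrow> (\<forall>\<^sub>F s in nhds t. g s = 0) \<or> (\<forall>\<^sub>F s in at t. g s \<noteq> 0)"
  shows "negligible {t \<in> T. g t = 0}"
proof -
  define S where "S = {t \<in> T. \<forall>\<^sub>F s in nhds t. g s = 0}"
  define E where "E = {t \<in> T. \<forall>\<^sub>F s in at t. g s \<noteq> 0}"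
  have "open S"
    unfolding open_subopen[of S]
  proof
    fix t assume "t \<in> S"
    then obtain U where "open U" "t \<in> U" "\<forall>s\<in>U. g s = 0"
      by (auto simp: S_def eventually_nhds)
    then show "\<exists>U. open U \<and> t \<in> U \<and> U \<subseteq> S"
      using \<open>t \<in> S\<close> \<open>open T\<close>
      by (intro exI[of _ "T \<inter> U"]) (auto simp: S_def eventually_nhds)
  qed
  have "open E"
    unfolding open_subopen[of E]
  proof
    fix t assume "t \<in> E"
    then obtain U where U: "open U" "t \<in> U" "\<And>s. s \<in> U \<Longrightarrow> s \<noteq> t \<Longrightarrow> g s \<noteq> 0"
      by (auto simp: E_def eventually_at_topological)
    have "\<forall>\<^sub>F s in at u. g s \<noteq> 0" if "u \<in> U" for u
    proof (cases "u = t")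
      case True
      then show ?thesis using \<open>t \<in> E\<close> by (simp add: E_def)
    next
      case False
      then show ?thesis
        unfolding eventually_at_topological using U that
        by (intro exI[of _ "U - {t}"]) (auto intro: open_Diff)
    qed
    then show "\<exists>U. open U \<and> t \<in> U \<and> U \<subseteq> E"
      using \<open>t \<in> E\<close> \<open>open T\<close> U by (intro exI[of _ "T \<inter> U"]) (auto simp: E_def)
  qed
  have "S \<inter> E = {}"
  proof -
    have "\<not> (\<forall>\<^sub>F s in nhds t. g s = 0)" if "\<forall>\<^sub>F s in at t. g s \<noteq> 0" for t
    proof
      assume "\<forall>\<^sub>F s in nhds t. g s = 0"
      then have "\<forall>\<^sub>F s in at t. g s = 0"
        by (rule filter_leD[OF at_within_le_nhds])
      then have "\<forall>\<^sub>F s in at t. False"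
        using that by eventually_elim simp
      then show False by simp
    qed
    then show ?thesis by (auto simp: S_def E_def)
  qed
  have "S \<union> E = T"
    using isolated by (auto simp: S_def E_def)
  have "t0 \<in> E"
    using isolated[OF \<open>t0 \<in> T\<close>] assms(3,4) by (auto simp: E_def dest: eventually_nhds_x_imp_x)
  then have "S = {}"
    using \<open>connected T\<close> \<open>open S\<close> \<open>open E\<close> \<open>S \<inter> E = {}\<close> \<open>S \<union> E = T\<close>
    unfolding connected_def by blast
  show ?thesis
  proof (rule locally_negligible_alt[THEN iffD2], rule)
    fix t assume t: "t \<in> {t \<in> T. g t = 0}"
    then have "t \<in> E"
      using \<open>S = {}\<close> \<open>S \<union> E = T\<close> by blast
    then have "\<forall>\<^sub>F s in at t. g s \<noteq> 0"
      by (simp add: E_def)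
    then obtain d where "0 < d" and d: "\<And>s. s \<noteq> t \<Longrightarrow> dist s t < d \<Longrightarrow> g s \<noteq> 0"
      by (auto simp: eventually_at)
    then have eq: "{t \<in> T. g t = 0} \<inter> ball t d = {t}"
    proof (intro equalityI subsetI)
      fix s assume "s \<in> {t \<in> T. g t = 0} \<inter> ball t d"
      then show "s \<in> {t}"
        using d[of s] by (auto simp: dist_commute)
    qed (use t \<open>0 < d\<close> in auto)
    have "openin (top_of_set {t \<in> T. g t = 0}) ({t \<in> T. g t = 0} \<inter> ball t d)"
      by (rule openin_open_Int) simp
    then show "\<exists>U. openin (top_of_set {t \<in> T. g t = 0}) U \<and> t \<in> U \<and> negligible U"
      unfolding eq by (intro exI[of _ "{t}"]) simp
  qed
qed

section \<open>From lines to null sets in higher dimension\<close>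

lemma AE_lborel_iff_negligible:
  fixes S :: "'a::euclidean_space set"
  assumes "S \<in> sets borel"
  shows "(AE x in lborel. x \<notin> S) \<longleftrightarrow> negligible S"
proof -
  have "(AE x in lebesgue. x \<notin> S) \<longleftrightarrow> S \<in> null_sets lebesgue"
    using assms by (intro AE_iff_null_sets[symmetric]) (auto intro: sets_completionI_sets)
  then show ?thesis
    by (simp add: negligible_iff_null_sets AE_completion_iff)
qed

text \<open>A substitute for polar coordinates: Fubini for the map taking \<open>x\<close> and
  \<open>s\<close> to \<open>s *\<^sub>R x\<close> shows that for almost every \<open>s\<close> the
  set of \<open>x\<close> mapped into \<open>Z\<close> is null. A single nonzero such
  \<open>s\<close> suffices, because \<open>Z\<close> is a dilate of that set.\<close>

lemma negligible_if_negligible_on_rays: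
  fixes Z :: "'a::euclidean_space set"
  assumes Z[measurable]: "Z \<in> sets borel"
    and rays: "\<And>x. negligible {s. s *\<^sub>R x \<in> Z}"
  shows "negligible Z"
proof -
  have preimage[measurable]: "{s. s *\<^sub>R x \<in> Z} \<in> sets borel" for x
    by measurable
  have preimage'[measurable]: "{x. s *\<^sub>R x \<in> Z} \<in> sets borel" for s :: real
    by measurable
  have "AE x in lborel. AE s in lborel. s *\<^sub>R x \<notin> Z"
    using AE_lborel_iff_negligible[OF preimage] rays by simp
  moreover have "{x \<in> space (lborel \<Otimes>\<^sub>M lborel). snd x *\<^sub>R fst x \<notin> Z} \<in> sets (lborel \<Otimes>\<^sub>M lborel)"
    by measurable
  ultimately have "AE s::real in lborel. AE x in lborel. s *\<^sub>R x \<notin> Z"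
    by (subst (asm) lborel_pair.AE_commute)
  then have ae: "AE s in lborel. negligible {x. s *\<^sub>R x \<in> Z}"
    using AE_lborel_iff_negligible[OF preimage'] by simp
  have "\<exists>s. s \<noteq> 0 \<and> negligible {x. s *\<^sub>R x \<in> Z}"
  proof (rule ccontr)
    assume "\<not> ?thesis"
    then have *: "negligible {x. s *\<^sub>R x \<in> Z} \<longrightarrow> s \<notin> - {0}" for s
      by blast
    have "AE s::real in lborel. s \<notin> - {0}"
      by (rule AE_mp[OF ae AE_I2]) (rule *)
    then have "negligible (- {0::real})"
      by (subst AE_lborel_iff_negligible[symmetric]) auto
    moreover have "1 \<in> - {0::real}"
      by simp
    ultimately show False
      using open_not_negligible[of "- {0::real}"] by blast
  qed
  then obtain s where "s \<noteq> 0" and neg: "negligible {x. s *\<^sub>R x \<in> Z}"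
    by blast
  have "Z = (\<lambda>x. s *\<^sub>R x + 0) ` {x. s *\<^sub>R x \<in> Z}"
    using \<open>s \<noteq> 0\<close> by (auto intro!: image_eqI[of _ _ "(1/s) *\<^sub>R x" for x])
  moreover have "emeasure lebesgue {x. s *\<^sub>R x \<in> Z} = 0"
    using neg unfolding negligible_iff_null_sets by (rule null_setsD1)
  ultimately have "emeasure lebesgue Z = 0"
    using emeasure_lebesgue_affine[of s 0 "{x. s *\<^sub>R x \<in> Z}"] by (metis mult_zero_right)
  moreover have "Z \<in> sets lebesgue"
    using Z by simp
  ultimately show ?thesis
    by (simp only: negligible_iff_emeasure0)
qed

text \<open>Move \<open>q\<close> to the origin. Every line through \<open>q\<close> meets the
  convex set \<open>B\<close> in an open interval, on which the function is analytic and nonzero at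
  parameter 0.\<close>

lemma negligible_level_set_real_analytic:
  fixes \<psi> :: "real^'m \<Rightarrow> real^'n"
  assumes analytic: "real_analytic_on \<psi> W" and cont: "continuous_on W \<psi>"
    and B: "B \<subseteq> W" "open B" "convex B" and q: "q \<in> B" "a \<bullet> \<psi> q \<noteq> b"
  shows "negligible {y \<in> B. a \<bullet> \<psi> y = b}"
proof -
  define Z where "Z = {y \<in> B. a \<bullet> \<psi> y = b}"
  define Z' where "Z' = {x. q + x \<in> Z}"
  have "closedin (top_of_set B) Z"
    unfolding Z_def
    by (intro continuous_closedin_preimage_constant continuous_intros continuous_on_subset[OF cont] B)
  then have "Z \<in> sets borel"
    using \<open>open B\<close> by (auto simp: closedin_closed)
  have "negligible Z'"
  proof (rule negligible_if_negligible_on_rays)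
    show "Z' \<in> sets borel"
      using \<open>Z \<in> sets borel\<close> unfolding Z'_def by measurable
    fix x
    define T where "T = {s. q + s *\<^sub>R x \<in> B}"
    have "open T"
      unfolding T_def using \<open>open B\<close>
      by (intro continuous_open_preimage[of UNIV, simplified vimage_def Int_UNIV_left, simplified] continuous_intros)
    moreover have "convex T"
    proof (rule convexI)
      fix s t u v :: real
      assume "s \<in> T" "t \<in> T" "0 \<le> u" "0 \<le> v" "u + v = 1"
      then have "u *\<^sub>R (q + s *\<^sub>R x) + v *\<^sub>R (q + t *\<^sub>R x) \<in> B"
        using \<open>convex B\<close> by (auto simp: T_def convex_def)
      also have "u *\<^sub>R (q + s *\<^sub>R x) + v *\<^sub>R (q + t *\<^sub>R x) = (u + v) *\<^sub>R q + (u * s + v * t) *\<^sub>R x"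
        by (simp add: algebra_simps)
      finally show "u *\<^sub>R s + v *\<^sub>R t \<in> T"
        using \<open>u + v = 1\<close> by (simp add: T_def)
    qed
    moreover have "0 \<in> T"
      using q by (simp add: T_def)
    moreover have "(\<forall>\<^sub>F s in nhds t. a \<bullet> \<psi> (q + s *\<^sub>R x) - b = 0) \<or> (\<forall>\<^sub>F s in at t. a \<bullet> \<psi> (q + s *\<^sub>R x) - b \<noteq> 0)"
      if "t \<in> T" for t
    proof -
      have "q + t *\<^sub>R x \<in> W"
        using that B by (auto simp: T_def)
      then obtain \<epsilon> c where "0 < \<epsilon>" "\<And>s. \<bar>s - t\<bar> < \<epsilon> \<Longrightarrow> (\<lambda>n. c n * (s - t) ^ n) sums (a \<bullet> \<psi> (q + s *\<^sub>R x) - b)"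
        using real_analytic_on_line[OF analytic] by metis
      then show ?thesis
        by (rule power_series_isolated_zeros)
    qed
    ultimately have "negligible {t \<in> T. a \<bullet> \<psi> (q + t *\<^sub>R x) - b = 0}"
      using q by (intro negligible_zeros_on_line[where ?t0.0 = 0]) (auto simp: convex_connected)
    then show "negligible {s. s *\<^sub>R x \<in> Z'}"
      by (simp add: T_def Z'_def Z_def)
  qed
  then have "negligible ((+) q ` Z')"
    by (rule negligible_translation)
  moreover have "(+) q ` Z' = Z"
    by (auto simp: Z'_def intro!: image_eqI[of _ _ "x - q" for x])
  ultimately show ?thesis
    by (simp add: Z_def)
qed

section \<open>Hyperplane sections in charts\<close>

lemma analytic_parametrizationsD:
  assumes "(\<psi>, W) \<in> analytic_parametrizations M"
  shows "open W" "real_analytic_on \<psi> W" "continuous_on W \<psi>" "\<psi> ` W \<subseteq> M"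
    and "\<And>U. open U \<Longrightarrow> U \<subseteq> W \<Longrightarrow> openin (top_of_set M) (\<psi> ` U)"
proof -
  obtain g where g: "homeomorphism W (\<psi> ` W) \<psi> g" and op: "openin (top_of_set M) (\<psi> ` W)"
    and *: "open W" "real_analytic_on \<psi> W"
    using assms by (auto simp: analytic_parametrizations_def)
  show "open W" "real_analytic_on \<psi> W" by fact+
  show "continuous_on W \<psi>"
    using g by (simp add: homeomorphism_def)
  show "\<psi> ` W \<subseteq> M"
    using op by (simp add: openin_imp_subset)
  fix U assume "open U" "U \<subseteq> W"
  then have "openin (top_of_set (\<psi> ` W)) (\<psi> ` U)"
    using homeomorphism_imp_open_map[OF g] by (simp add: open_subset)
  then show "openin (top_of_set M) (\<psi> ` U)"
    using op openin_trans by blast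
qed

text \<open>Analytic continuation on \<open>M\<close>: the set \<open>S\<close> of points near which
  \<open>M\<close> lies in the hyperplane is open and closed, and it is not all of \<open>M\<close>,
  hence empty. So every ball in a chart contains a point off the hyperplane.\<close>

lemma negligible_chart_hyperplane:
  fixes M :: "(real^'n) set" and \<psi> :: "real^'m \<Rightarrow> real^'n"
  assumes M: "analytic_submanifold TYPE('m) M" "connected M" "\<not> M \<subseteq> {y. a \<bullet> y = b}"
    and chart: "(\<psi>, W) \<in> analytic_parametrizations M"
  shows "negligible {w \<in> W. a \<bullet> \<psi> w = b}"
proof -
  define H where "H = {y. a \<bullet> y = b}"
  define S where "S = {p \<in> M. \<exists>U. openin (top_of_set M) U \<and> p \<in> U \<and> U \<subseteq> H}"
  have ball: "negligible {y \<in> ball w r. a \<bullet> \<phi> y = b}"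
    if "(\<phi>, V) \<in> analytic_parametrizations M" "ball w r \<subseteq> V" "\<phi> w \<notin> S" "0 < r"
    for \<phi> :: "real^'m \<Rightarrow> real^'n" and V w r
  proof -
    note D = analytic_parametrizationsD[OF that(1)]
    have "\<phi> w \<in> \<phi> ` ball w r"
      using that(4) by simp
    moreover from this have "\<phi> w \<in> M"
      using D(4) that(2) by (meson image_mono subsetD)
    moreover have "openin (top_of_set M) (\<phi> ` ball w r)"
      using D(5) that(2) by simp
    ultimately have "\<not> \<phi> ` ball w r \<subseteq> H"
      using that(3) unfolding S_def by blast
    then obtain q where q: "q \<in> ball w r" "a \<bullet> \<phi> q \<noteq> b"
      unfolding H_def by blast
    show ?thesis
      by (rule negligible_level_set_real_analytic[OF D(2,3) that(2) _ _ q]) simp_all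
  qed
  have "openin (top_of_set M) S"
  proof (rule openin_subopen[THEN iffD2], rule)
    fix p assume "p \<in> S"
    then obtain U where U: "openin (top_of_set M) U" "p \<in> U" "U \<subseteq> H"
      by (auto simp: S_def)
    moreover from U have "U \<subseteq> S"
      using openin_imp_subset[OF U(1)] by (auto simp: S_def)
    ultimately show "\<exists>T. openin (top_of_set M) T \<and> p \<in> T \<and> T \<subseteq> S"
      by blast
  qed
  moreover have "openin (top_of_set M) (M - S)"
  proof (rule openin_subopen[THEN iffD2], rule)
    fix p assume p: "p \<in> M - S"
    obtain \<phi> :: "real^'m \<Rightarrow> real^'n" and V w where \<phi>: "(\<phi>, V) \<in> analytic_parametrizations M" and "w \<in> V" "p = \<phi> w"
      using M(1) p unfolding analytic_submanifold_def by blast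
    note D = analytic_parametrizationsD[OF \<phi>]
    obtain r where r: "0 < r" "ball w r \<subseteq> V"
      using D(1) \<open>w \<in> V\<close> open_contains_ball by blast
    have neg: "negligible {y \<in> ball w r. a \<bullet> \<phi> y = b}"
      using ball[OF \<phi> r(2)] r p \<open>p = \<phi> w\<close> by auto
    \<comment> \<open>A point of \<open>S\<close> in this ball would put a nonempty open set inside
      the negligible zero set.\<close>
    have "\<phi> y \<notin> S" if "y \<in> ball w r" for y
    proof
      assume "\<phi> y \<in> S"
      then obtain U where U: "openin (top_of_set M) U" "\<phi> y \<in> U" "U \<subseteq> H"
        by (auto simp: S_def)
      then obtain O' where O': "open O'" "U = M \<inter> O'"
        by (auto simp: openin_open)
      have "continuous_on (ball w r) \<phi>"
        using D(3) r continuous_on_subset by blast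
      then have "open (ball w r \<inter> \<phi> -` O')"
        using O'(1) continuous_open_preimage open_ball by blast
      moreover have "y \<in> ball w r \<inter> \<phi> -` O'"
        using that U(2) O'(2) by auto
      ultimately have "\<not> negligible (ball w r \<inter> \<phi> -` O')"
        using open_not_negligible by blast
      moreover have "ball w r \<inter> \<phi> -` O' \<subseteq> {y \<in> ball w r. a \<bullet> \<phi> y = b}"
        using U(3) O'(2) D(4) r(2) by (auto simp: H_def)
      ultimately show False
        using neg negligible_subset by blast
    qed
    then have "\<phi> ` ball w r \<subseteq> M - S"
      using D(4) r(2) by auto
    moreover have "p \<in> \<phi> ` ball w r"
      using r(1) \<open>p = \<phi> w\<close> by simp
    moreover have "openin (top_of_set M) (\<phi> ` ball w r)"
      using D(5) r(2) by simp
    ultimately show "\<exists>T. openin (top_of_set M) T \<and> p \<in> T \<and> T \<subseteq> M - S"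
      by blast
  qed
  moreover have "S \<noteq> M"
    using M(3) by (auto simp: S_def H_def)
  moreover have "S \<subseteq> M"
    by (auto simp: S_def)
  ultimately have "S = {}"
    using M(2) unfolding connected_clopen closedin_def by auto
  note D = analytic_parametrizationsD[OF chart]
  show ?thesis
  proof (rule locally_negligible_alt[THEN iffD2], rule)
    fix z assume z: "z \<in> {w \<in> W. a \<bullet> \<psi> w = b}"
    then obtain r where r: "0 < r" "ball z r \<subseteq> W"
      using D(1) open_contains_ball by blast
    then have "negligible ({w \<in> W. a \<bullet> \<psi> w = b} \<inter> ball z r)"
      using ball[OF chart r(2)] \<open>S = {}\<close> by (auto elim: negligible_subset)
    moreover have "openin (top_of_set {w \<in> W. a \<bullet> \<psi> w = b}) ({w \<in> W. a \<bullet> \<psi> w = b} \<inter> ball z r)"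
      by (rule openin_open_Int) simp
    ultimately show "\<exists>U. openin (top_of_set {w \<in> W. a \<bullet> \<psi> w = b}) U \<and> z \<in> U \<and> negligible U"
      using z r by (intro exI[of _ "{w \<in> W. a \<bullet> \<psi> w = b} \<inter> ball z r"]) auto
  qed
qed

section \<open>Null sets of the volume measure\<close>

lemma emeasure_density_eq_0:
  assumes "N \<in> null_sets \<mu>"
  shows "emeasure (density \<mu> f) N = 0"
proof -
  \<comment> \<open>No measurability of \<open>f\<close>: if the defining set function is not a measure, its value is the default 0.\<close>
  have "(\<integral>\<^sup>+ x. f x * indicator N x \<partial>\<mu>) = (\<integral>\<^sup>+ x. 0 \<partial>\<mu>)"
    using AE_not_in[OF assms] by (intro nn_integral_cong_AE) auto
  then show ?thesis
    unfolding density_def by (simp add: emeasure_measure_of_conv)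
qed

lemma emeasure_chart_volume_eq_0:
  fixes \<psi> :: "real^'m \<Rightarrow> real^'n"
  assumes chart: "(\<psi>, W) \<in> analytic_parametrizations M"
    and N: "N \<in> sets (restrict_space borel M)" and neg: "negligible {w \<in> W. \<psi> w \<in> N}"
  shows "emeasure (chart_volume M \<psi> W) N = 0"
proof -
  note D = analytic_parametrizationsD[OF chart]
  let ?\<mu> = "restrict_space lborel W"
  have "\<psi> \<in> borel_measurable (restrict_space borel W)"
    using D(3) by (rule borel_measurable_continuous_on_restrict)
  then have "\<psi> \<in> restrict_space borel W \<rightarrow>\<^sub>M restrict_space borel M"
    using D(4) by (intro measurable_restrict_space2) (auto simp: space_restrict_space)
  then have \<psi>: "\<psi> \<in> ?\<mu> \<rightarrow>\<^sub>M restrict_space borel M"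
    by (subst measurable_cong_sets[of _ "restrict_space borel W"]) (simp_all add: sets_restrict_space)
  have pre: "\<psi> -` N \<inter> space ?\<mu> = {w \<in> W. \<psi> w \<in> N}"
    by (auto simp: space_restrict_space)
  have "{w \<in> W. \<psi> w \<in> N} \<in> sets ?\<mu>"
    using measurable_sets[OF \<psi> N] unfolding pre .
  then have "{w \<in> W. \<psi> w \<in> N} \<in> sets borel"
    using D(1) by (subst (asm) sets_restrict_space_iff) auto
  moreover have "AE x in lborel. x \<notin> {w \<in> W. \<psi> w \<in> N}"
    using AE_lborel_iff_negligible[OF calculation] neg by simp
  ultimately have "{w \<in> W. \<psi> w \<in> N} \<in> null_sets lborel"
    by (subst AE_iff_null_sets) auto
  then have "{w \<in> W. \<psi> w \<in> N} \<in> null_sets ?\<mu>"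
    using D(1) by (subst null_sets_restrict_space) auto
  then show ?thesis
    using \<psi> N unfolding chart_volume_def
    by (subst emeasure_distr) (simp_all add: pre emeasure_density_eq_0)
qed

text \<open>A supremum of measures is not computed setwise, so the argument goes through the least
  upper bound property.\<close>

lemma null_sets_SUP_measure:
  assumes "I \<noteq> {}" and sets: "\<And>i. i \<in> I \<Longrightarrow> sets (C i) = sets \<nu>"
    and N: "N \<in> sets \<nu>" and null: "\<And>i. i \<in> I \<Longrightarrow> emeasure (C i) N = 0"
  shows "N \<in> null_sets (SUP i\<in>I. C i)"
proof -
  define \<mu> where "\<mu> = (SUP i\<in>I. C i)"
  have sets_\<mu>: "sets \<mu> = sets \<nu>"
    unfolding \<mu>_def using sets_SUP[of I C \<nu>] assms by blast
  then have N_\<mu>: "N \<in> sets \<mu>"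
    using N by simp
  \<comment> \<open>Removing \<open>N\<close> from the supremum leaves an upper bound of all \<open>C i\<close>.\<close>
  define \<mu>' where "\<mu>' = density \<mu> (indicator (space \<mu> - N))"
  have \<mu>': "emeasure \<mu>' X = emeasure \<mu> (X - N)" if "X \<in> sets \<mu>" for X
  proof -
    have ind: "(indicator (space \<mu> - N) x * indicator X x :: ennreal) = indicator (X - N) x" if "x \<in> space \<mu>" for x
      using that by (auto simp: indicator_def)
    have "emeasure \<mu>' X = (\<integral>\<^sup>+ x. indicator (space \<mu> - N) x * indicator X x \<partial>\<mu>)"
      using that N_\<mu> unfolding \<mu>'_def by (subst emeasure_density) auto
    also have "\<dots> = (\<integral>\<^sup>+ x. indicator (X - N) x \<partial>\<mu>)"
      by (rule nn_integral_cong) (rule ind)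
    finally have "emeasure \<mu>' X = (\<integral>\<^sup>+ x. indicator (X - N) x \<partial>\<mu>)" .
    then show ?thesis
      using that N_\<mu> by simp
  qed
  have "C i \<le> \<mu>'" if "i \<in> I" for i
  proof (subst le_measure)
    show "sets (C i) = sets \<mu>'"
      using sets[OF that] sets_\<mu> by (simp add: \<mu>'_def)
    show "\<forall>A\<in>sets (C i). emeasure (C i) A \<le> emeasure \<mu>' A"
    proof
      fix A assume "A \<in> sets (C i)"
      then have A: "A \<in> sets \<mu>"
        using sets[OF that] sets_\<mu> by simp
      have "emeasure (C i) A \<le> emeasure (C i) ((A - N) \<union> N)"
        using A N_\<mu> sets[OF that] sets_\<mu> by (intro emeasure_mono) auto
      also have "\<dots> \<le> emeasure (C i) (A - N) + emeasure (C i) N"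
        using A N_\<mu> sets[OF that] sets_\<mu> by (intro emeasure_subadditive) auto
      also have "\<dots> = emeasure (C i) (A - N)"
        using null[OF that] by simp
      also have "\<dots> \<le> emeasure \<mu> (A - N)"
        using le_measureD3[of "C i" \<mu>] SUP_upper[OF that, of C] sets[OF that] sets_\<mu>
        by (simp add: \<mu>_def)
      finally show "emeasure (C i) A \<le> emeasure \<mu>' A"
        using \<mu>'[OF A] by simp
    qed
  qed
  then have "\<mu> \<le> \<mu>'"
    unfolding \<mu>_def by (intro SUP_least)
  then have "emeasure \<mu> N \<le> emeasure \<mu>' N"
    by (rule le_measureD3) (simp add: \<mu>'_def)
  then show ?thesis
    using \<mu>'[OF N_\<mu>] N_\<mu> by (auto simp: \<mu>_def[symmetric])
qed

lemma AE_submanifold_volume_not_in_hyperplane: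
  fixes M :: "(real^'n) set"
  assumes M: "analytic_submanifold TYPE('m::finite) M" "connected M" "\<not> M \<subseteq> {y. a \<bullet> y = b}"
  shows "AE x in submanifold_volume TYPE('m) M. a \<bullet> x \<noteq> b"
proof -
  define N where "N = M \<inter> {y. a \<bullet> y = b}"
  define P where "P = (analytic_parametrizations M :: ((real^'m \<Rightarrow> real^'n) \<times> (real^'m) set) set)"
  obtain p where "p \<in> M"
    using M(3) by blast
  \<comment> \<open>A nonempty family of charts is needed for the supremum to carry the
    sigma-algebra of \<open>M\<close>.\<close>
  then have "P \<noteq> {}"
    using M(1) unfolding analytic_submanifold_def P_def by blast
  have sets: "sets (case i of (\<psi>, W) \<Rightarrow> chart_volume M \<psi> W) = sets (restrict_space borel M)"
    for i :: "(real^'m \<Rightarrow> real^'n) \<times> (real^'m) set"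
    by (cases i) (simp add: chart_volume_def)
  have N: "N \<in> sets (restrict_space borel M)"
    unfolding N_def sets_restrict_space by (intro imageI) (simp add: closed_hyperplane borel_closed)
  have "emeasure (case i of (\<psi>, W) \<Rightarrow> chart_volume M \<psi> W) N = 0" if "i \<in> P" for i
  proof -
    obtain \<psi> W where i: "i = (\<psi>, W)"
      by (cases i)
    have chart: "(\<psi>, W) \<in> analytic_parametrizations M"
      using that by (simp add: P_def i)
    have "{w \<in> W. \<psi> w \<in> N} = {w \<in> W. a \<bullet> \<psi> w = b}"
      using analytic_parametrizationsD(4)[OF chart] by (auto simp: N_def)
    then show ?thesis
      using emeasure_chart_volume_eq_0[OF chart N] negligible_chart_hyperplane[OF M chart] by (simp add: i)
  qed
  then have "N \<in> null_sets (submanifold_volume TYPE('m) M)"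
    unfolding submanifold_volume_def P_def[symmetric]
    using \<open>P \<noteq> {}\<close> sets N by (intro null_sets_SUP_measure)
  moreover have "space (submanifold_volume TYPE('m) M) = M"
    using sets_SUP[OF sets \<open>P \<noteq> {}\<close>, THEN sets_eq_imp_space_eq]
    unfolding submanifold_volume_def P_def[symmetric] by (simp add: space_restrict_space)
  ultimately show ?thesis
    by (intro AE_I'[of N]) (auto simp: N_def)
qed

text \<open>Only countably many hyperplanes have integer coefficients, and each contributes a null
  set.\<close>

lemma AE_submanifold_volume_rationally_independent:
  fixes M :: "(real^'n) set"
  assumes M: "analytic_submanifold TYPE('m::finite) M" "connected M"
    and nonplanar: "\<not> (\<exists>a b. a \<noteq> 0 \<and> M \<subseteq> {y. a \<bullet> y = b})"
  shows "AE x in submanifold_volume TYPE('m) M.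
    \<forall>a\<in>integer_lattice. \<forall>b\<in>\<int>. a \<noteq> 0 \<longrightarrow> a \<bullet> x \<noteq> b"
proof (subst AE_ball_countable[OF countable_integer_lattice], intro ballI)
  fix a :: "real^'n"
  show "AE x in submanifold_volume TYPE('m) M. \<forall>b\<in>\<int>. a \<noteq> 0 \<longrightarrow> a \<bullet> x \<noteq> b"
  proof (subst AE_ball_countable[OF countable_int], intro ballI)
    fix b :: real
    show "AE x in submanifold_volume TYPE('m) M. a \<noteq> 0 \<longrightarrow> a \<bullet> x \<noteq> b"
    proof (cases "a = 0")
      case False
      then show ?thesis
        using AE_submanifold_volume_not_in_hyperplane[OF M] nonplanar by (auto elim: AE_mp)
    qed simp
  qed
qed

theorem corollary1p12:
  fixes \<omega> :: "real ^ ('n::{finite,linorder}) option"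
    and M :: "(real ^ ('n::{finite,linorder})) set"
  assumes "weight_vector \<omega>"
    and "analytic_submanifold TYPE('m::finite) M"
    and "connected M"
    and "\<not> (\<exists>a b. a \<noteq> 0 \<and> M \<subseteq> {y. a \<bullet> y = b})"
  shows "AE x in submanifold_volume TYPE('m) M. connected_minima \<omega> (lattice_of x)"
  using AE_submanifold_volume_rationally_independent[OF assms(2-4)]
proof (rule AE_mp, intro AE_I2 impI)
  fix x :: "real ^ 'n::_"
  assume x: "\<forall>a\<in>integer_lattice. \<forall>b\<in>\<int>. a \<noteq> 0 \<longrightarrow> a \<bullet> x \<noteq> b"
  show "connected_minima \<omega> (lattice_of x)"
  proof (rule connected_minima_if_irrational[OF assms(1)])
    fix v :: "real ^ ('n::_) option"
    assume v: "v \<in> integer_lattice" "v \<noteq> 0"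
    \<comment> \<open>Splitting \<open>v\<close> into its first coordinate and \<open>a\<close>
      turns the vanishing of the first coordinate of \<open>unipotent x *v v\<close> into an integer
      affine relation for \<open>x\<close>.\<close>
    define a where "a = (\<chi> j. v $ Some j)"
    have eq: "(unipotent x *v v) $ None = v $ None + a \<bullet> x"
      by (simp add: unipotent_mult_None inner_vec_def a_def mult.commute)
    show "(unipotent x *v v) $ None \<noteq> 0"
    proof (cases "a = 0")
      case True
      then have "v $ Some j = 0" for j
        by (simp add: a_def vec_eq_iff)
      then have "v $ None \<noteq> 0"
        using v(2) by (metis not_None_eq vec_eq_iff zero_index)
      then show ?thesis
        using eq True by simp
    next
      case False
      have "a \<in> integer_lattice" "- (v $ None) \<in> \<int>"
        using v(1) by (simp_all add: integer_lattice_def a_def)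
      then have "a \<bullet> x \<noteq> - (v $ None)"
        using x False by blast
      then show ?thesis
        using eq by simp
    qed
  qed
qed

end
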